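(* Let $\rho_1,\rho_2$ be convex expectations on $L^\infty(\mu)$ that are continuous from below, and suppose that there exist two constants $u>\max\{0,M-\rho_1(0)+1\}$ and $v>\max\{0,M-\rho_2(0)+1\}$ such that $\mathcal{G}_u$ and $\mathcal{H}_v$ are both closed under $\mu$-a.e. convergence. Then there exists $Q^*\in\mathcal{Q}$ such that for any optimal test $X^*$ of the problem of minimizing $\rho_2(K_2-X)$ over $X\in\mathcal{X}_\alpha$, $$E_{Q^*}[K_2-X^*]=\inf_{X\in\mathcal{X}_\alpha}E_{Q^*}[K_2-X].$$
   Context: $(\Omega,\mathcal{F},\mu)$ is a probability space and $\mathcal{M}$ is the set of probability measures on $(\Omega,\mathcal{F})$ absolutely continuous with respect to $\mu$. For $P,Q\in\mathcal{M}$ write $G_P=\frac{dP}{d\mu}$ and $H_Q=\frac{dQ}{d\mu}$. A convex expectation on $L^\infty(\mu)$ is a map $\rho:L^\infty(\mu)\to\mathbb{R}$ such that for all $X,Y\in L^\infty(\mu)$: (i) $X\ge Y$ implies $\rho(X)\ge\rho(Y)$; (ii) $\rho(X+c)=\rho(X)+c$ for every constant $c$; (iii) $\rho(\lambda X+(1-\lambda)Y)\le\lambda\rho(X)+(1-\lambda)\rho(Y)$ for $\lambda\in[0,1]$. It is continuous from below if $\rho(X_n)\to\rho(X)$ whenever $(X_n)\subset L^\infty(\mu)$ increases to $X\in L^\infty(\mu)$. The penalty function is $\rho^*(P)=\sup_{X\in L^\infty(\mu)}(E_P[X]-\rho(X))$ for $P\in\mathcal{M}$. $\mathcal{P}=\{P\in\mathcal{M}:\rho_1^*(P)<\infty\}$,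 $\mathcal{Q}=\{Q\in\mathcal{M}:\rho_2^*(Q)<\infty\}$, and for a constant $c$, $\mathcal{G}_c=\{G_P:P\in\mathcal{P},\ \rho_1^*(P)\le c\}$, $\mathcal{H}_c=\{H_Q:Q\in\mathcal{Q},\ \rho_2^*(Q)\le c\}$. A set of random variables is closed under $\mu$-a.e. convergence if the $\mu$-a.e. limit of any $\mu$-a.e. convergent sequence in it belongs to it. $K_1,K_2\in L^\infty(\mu)$ are fixed with $0\le K_1<K_2$ ($\mu$-a.e.), $M$ is the least (essential) upper bound of $K_1$ and $K_2$, and $\alpha$ is a fixed real number (significance level) with $\rho_1(K_1)\le\alpha\le\rho_1(K_2)$. $\mathcal{X}_\alpha=\{X\in L^\infty(\mu):K_1\le X\le K_2,\ \rho_1(X)\le\alpha\}$. An optimal test is an $X^*\in\mathcal{X}_\alpha$ with $\rho_2(K_2-X^* )=\inf_{X\in\mathcal{X}_\alpha}\rho_2(K_2-X)$. *)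

theory Defs
  imports "HOL-Probability.Probability"
begin

text \<open>
  Elements of L-infinity are represented by functions rather than by classes modulo
  \<open>\<mu>\<close>-a.e. equality. All order relations are \<open>\<mu>\<close>-a.e., so monotonicity makes a convex
  expectation invariant under changes on null sets.
\<close>

definition Linf :: "'a measure \<Rightarrow> ('a \<Rightarrow> real) set" where
  "Linf \<mu> = {X \<in> borel_measurable \<mu>. \<exists>C. AE \<omega> in \<mu>. \<bar>X \<omega>\<bar> \<le> C}"

definition convex_expectation :: "'a measure \<Rightarrow> (('a \<Rightarrow> real) \<Rightarrow> real) \<Rightarrow> bool" where
  "convex_expectation \<mu> \<rho> \<longleftrightarrow>
     (\<forall>X\<in>Linf \<mu>. \<forall>Y\<in>Linf \<mu>. (AE \<omega> in \<mu>. X \<omega> \<ge> Y \<omega>) \<longrightarrow> \<rho> X \<ge> \<rho> Y) \<and>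
     (\<forall>X\<in>Linf \<mu>. \<forall>c. \<rho> (\<lambda>\<omega>. X \<omega> + c) = \<rho> X + c) \<and>
     (\<forall>X\<in>Linf \<mu>. \<forall>Y\<in>Linf \<mu>. \<forall>l\<in>{0..1}.
        \<rho> (\<lambda>\<omega>. l * X \<omega> + (1 - l) * Y \<omega>) \<le> l * \<rho> X + (1 - l) * \<rho> Y)"

definition continuous_from_below :: "'a measure \<Rightarrow> (('a \<Rightarrow> real) \<Rightarrow> real) \<Rightarrow> bool" where
  "continuous_from_below \<mu> \<rho> \<longleftrightarrow>
     (\<forall>Xs X. (\<forall>n. Xs n \<in> Linf \<mu>) \<longrightarrow> X \<in> Linf \<mu> \<longrightarrow>
        (AE \<omega> in \<mu>. incseq (\<lambda>n. Xs n \<omega>) \<and> (\<lambda>n. Xs n \<omega>) \<longlonglongrightarrow> X \<omega>) \<longrightarrow>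
        (\<lambda>n. \<rho> (Xs n)) \<longlonglongrightarrow> \<rho> X)"

definition ac_prob_measures :: "'a measure \<Rightarrow> 'a measure set" where
  "ac_prob_measures \<mu> = {P. prob_space P \<and> sets P = sets \<mu> \<and> absolutely_continuous \<mu> P}"

definition penalty :: "'a measure \<Rightarrow> (('a \<Rightarrow> real) \<Rightarrow> real) \<Rightarrow> 'a measure \<Rightarrow> ereal" where
  "penalty \<mu> \<rho> P = (SUP X\<in>Linf \<mu>. ereal ((LINT \<omega>|P. X \<omega>) - \<rho> X))"

text \<open>For \<open>\<rho>\<^sub>1\<close>, \<open>\<rho>\<^sub>2\<close> this gives the sets \<open>\<P>\<close> and \<open>\<Q>\<close>.\<close>

definition finite_penalty_measures ::
    "'a measure \<Rightarrow> (('a \<Rightarrow> real) \<Rightarrow> real) \<Rightarrow> 'a measure set" where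
  "finite_penalty_measures \<mu> \<rho> = {P \<in> ac_prob_measures \<mu>. penalty \<mu> \<rho> P < \<infinity>}"

text \<open>
  For \<open>\<rho>\<^sub>1\<close>, \<open>\<rho>\<^sub>2\<close> this gives the sets \<open>\<G>\<^sub>c\<close> and \<open>\<H>\<^sub>c\<close>. Every real-valued version of a
  density is included, as random variables are identified when they agree \<open>\<mu>\<close>-a.e.
\<close>

definition penalty_level_densities ::
    "'a measure \<Rightarrow> (('a \<Rightarrow> real) \<Rightarrow> real) \<Rightarrow> real \<Rightarrow> ('a \<Rightarrow> real) set" where
  "penalty_level_densities \<mu> \<rho> c =
     {G \<in> borel_measurable \<mu>. \<exists>P\<in>finite_penalty_measures \<mu> \<rho>.
        penalty \<mu> \<rho> P \<le> ereal c \<and> (AE \<omega> in \<mu>. G \<omega> = enn2real (RN_deriv \<mu> P \<omega>))}"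

definition closed_under_ae_convergence :: "'a measure \<Rightarrow> ('a \<Rightarrow> real) set \<Rightarrow> bool" where
  "closed_under_ae_convergence \<mu> S \<longleftrightarrow>
     (\<forall>Gs G. (\<forall>n. Gs n \<in> S) \<longrightarrow> G \<in> borel_measurable \<mu> \<longrightarrow>
        (AE \<omega> in \<mu>. (\<lambda>n. Gs n \<omega>) \<longlonglongrightarrow> G \<omega>) \<longrightarrow> G \<in> S)"

text \<open>
  The constant \<open>M\<close>: the least real that bounds both functions from above \<open>\<mu>\<close>-a.e.
  The essential supremum is finite for functions in \<open>Linf \<mu>\<close> on a probability space.
\<close>

definition least_ess_upper_bound :: "'a measure \<Rightarrow> ('a \<Rightarrow> real) \<Rightarrow> ('a \<Rightarrow> real) \<Rightarrow> real" where
  "least_ess_upper_bound \<mu> K1 K2 =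
     real_of_ereal (esssup \<mu> (\<lambda>\<omega>. ereal (max (K1 \<omega>) (K2 \<omega>))))"

definition admissible_tests ::
    "'a measure \<Rightarrow> (('a \<Rightarrow> real) \<Rightarrow> real) \<Rightarrow> ('a \<Rightarrow> real) \<Rightarrow> ('a \<Rightarrow> real) \<Rightarrow> real \<Rightarrow>
     ('a \<Rightarrow> real) set" where
  "admissible_tests \<mu> \<rho>1 K1 K2 \<alpha> =
     {X \<in> Linf \<mu>. (AE \<omega> in \<mu>. K1 \<omega> \<le> X \<omega> \<and> X \<omega> \<le> K2 \<omega>) \<and> \<rho>1 X \<le> \<alpha>}"

text \<open>
  The real infimum below is a genuine one under the hypotheses of the theorem: \<open>K1\<close> is
  admissible when \<open>\<rho>1 K1 \<le> \<alpha>\<close>, and \<open>\<rho>2 (\<lambda>_. 0)\<close> is a lower bound by monotonicity.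
\<close>

definition optimal_test ::
    "'a measure \<Rightarrow> (('a \<Rightarrow> real) \<Rightarrow> real) \<Rightarrow> (('a \<Rightarrow> real) \<Rightarrow> real) \<Rightarrow>
     ('a \<Rightarrow> real) \<Rightarrow> ('a \<Rightarrow> real) \<Rightarrow> real \<Rightarrow> ('a \<Rightarrow> real) \<Rightarrow> bool" where
  "optimal_test \<mu> \<rho>1 \<rho>2 K1 K2 \<alpha> X' \<longleftrightarrow>
     X' \<in> admissible_tests \<mu> \<rho>1 K1 K2 \<alpha> \<and>
     \<rho>2 (\<lambda>\<omega>. K2 \<omega> - X' \<omega>) =
       (INF X\<in>admissible_tests \<mu> \<rho>1 K1 K2 \<alpha>. \<rho>2 (\<lambda>\<omega>. K2 \<omega> - X \<omega>))"

end

theory Submission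
  imports Defs
begin

text \<open>
  Let \<open>S\<close> be the set of shortfalls \<open>K2 - X\<close> of the admissible tests \<open>X\<close> and \<open>m\<close> the infimum of \<open>\<rho>2\<close>
  on \<open>S\<close>. It suffices to find \<open>Q\<close> of finite penalty with
  \<open>E\<^sub>Q W - \<rho>2 W \<le> E\<^sub>Q Z - m\<close> for all bounded \<open>W\<close> and all \<open>Z \<in> S\<close>: if \<open>X'\<close> is optimal, then
  \<open>W = K2 - X'\<close> has \<open>\<rho>2 W = m\<close>, and the inequality says that \<open>W\<close> minimizes \<open>E\<^sub>Q\<close> on \<open>S\<close>. So \<open>Q\<close> is
  a maximizer in the minimax identity between \<open>inf\<^sub>S \<rho>2\<close> and the penalized linear problems.

  A linear functional with this inequality exists by the Hahn-Banach theorem, but it need not be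
  countably additive. Countable additivity is forced by an argument in the spirit of the
  Krein-Smulian theorem. Continuity from below makes \<open>\<rho>1\<close> and \<open>\<rho>2\<close> lower semicontinuous along
  bounded a.e. convergent sequences (\<open>rho_fatou\<close>). For \<open>\<rho>1\<close> this shows that \<open>S\<close>, which is bounded and
  convex, is closed under a.e. limits. Such sets are compact in the following sense: every sequence
  in \<open>S\<close> has convex combinations of its tails that converge a.e. to an element of \<open>S\<close>
  (\<open>bounded_closed_convex_komlos\<close>). Hence, for \<open>d < m\<close>, there is \<open>\<eta>\<^sub>0 > 0\<close> such that \<open>\<rho>2\<close> stays above \<open>d\<close> when functions
  with values in the unit interval and integral at most \<open>\<eta>\<^sub>0\<close> are subtracted from elements of \<open>S\<close>
  (\<open>rho_gap_stable\<close>); the enlarged set is again of the same kind, so this can be iterated with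
  \<open>\<eta>\<^sub>1, \<eta>\<^sub>2, \<dots>\<close>. The union \<open>C\<close> of the enlargements is convex, contains \<open>Z - j 1\<^sub>A\<close> whenever
  \<open>A\<close> is small enough depending on \<open>j\<close>, and still satisfies \<open>\<rho>2 > d\<close> (\<open>absorbing_enlargement\<close>).
  A functional that supports \<open>\<rho>2\<close> over \<open>C\<close> is bounded below on \<open>C\<close>, so its value at
  \<open>1\<^sub>A\<close> is at most of order \<open>1/j\<close>; it is therefore an absolutely continuous probability measure, and it
  satisfies the required inequality up to \<open>m - d\<close> (\<open>approximate_minimizing_measure\<close>).

  The error is removed by the hypothesis on the level set of the penalty at \<open>v\<close>. The
  approximate measures have penalty at most \<open>M - m + 1 \<le> M - \<rho>2 0 + 1 < v\<close>. Convex combinations of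
  their densities converge a.e., and closedness makes the limit the density of a probability measure
  of finite penalty. No mass is lost in the limit, so the convergence is in \<open>L\<^sup>1\<close> by Scheffe's
  lemma and the inequality passes to the limit (\<open>minimizing_measure\<close>).
\<close>

section \<open>Averages of tails and a.e. convergence\<close>

text \<open>
A convex combination of \<open>s n, s (n + 1), \<dots>\<close> is represented by the operator that maps the sequence
\<open>s\<close> to its value. One operator can thus be applied pointwise to several sequences of functions and to
the sequences of their integrals, and every compatibility with convex combinations is a rule induction
over two-point combinations, without handling weights.
\<close>

inductive tail_average :: "nat \<Rightarrow> ((nat \<Rightarrow> real) \<Rightarrow> real) \<Rightarrow> bool" for n where
  point: "n \<le> k \<Longrightarrow> tail_average n (\<lambda>s. s k)"
| mix: "tail_average n T \<Longrightarrow> tail_average n U \<Longrightarrow> 0 \<le> l \<Longrightarrow> l \<le> 1 \<Longrightarrow>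
    tail_average n (\<lambda>s. l * T s + (1 - l) * U s)"

lemma tail_average_antimono: "tail_average n T \<Longrightarrow> m \<le> n \<Longrightarrow> tail_average m T"
  by (induction rule: tail_average.induct) (auto intro: tail_average.intros)

lemma tail_average_linear:
  "tail_average n T \<Longrightarrow> T (\<lambda>k. a * s k + b * t k + c) = a * T s + b * T t + c"
  by (induction rule: tail_average.induct) (simp_all add: algebra_simps)

lemma tail_average_add_const: "tail_average n T \<Longrightarrow> T (\<lambda>k. s k + c) = T s + c"
  using tail_average_linear[of n T 1 s 0 s c] by simp

lemma tail_average_diff: "tail_average n T \<Longrightarrow> T (\<lambda>k. s k - t k) = T s - T t"
  using tail_average_linear[of n T 1 s "-1" t 0] by simp

lemma tail_average_mono:
  "tail_average n T \<Longrightarrow> (\<And>k. n \<le> k \<Longrightarrow> s k \<le> t k) \<Longrightarrow> T s \<le> T t"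
  by (induction rule: tail_average.induct) (auto intro!: add_mono mult_left_mono)

lemma tail_average_const: "tail_average n T \<Longrightarrow> T (\<lambda>k. c) = c"
  by (induction rule: tail_average.induct) (auto simp: algebra_simps)

lemma tail_average_le: "tail_average n T \<Longrightarrow> (\<And>k. n \<le> k \<Longrightarrow> s k \<le> c) \<Longrightarrow> T s \<le> c"
  using tail_average_mono[of n T s "\<lambda>_. c"] tail_average_const[of n T c] by simp

lemma tail_average_ge: "tail_average n T \<Longrightarrow> (\<And>k. n \<le> k \<Longrightarrow> c \<le> s k) \<Longrightarrow> c \<le> T s"
  using tail_average_mono[of n T "\<lambda>_. c" s] tail_average_const[of n T c] by simp

lemma tail_average_tendsto:
  assumes "\<And>n. tail_average n (T n)" and "s \<longlonglongrightarrow> L"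
  shows "(\<lambda>n. T n s) \<longlonglongrightarrow> L"
proof (rule LIMSEQ_I)
  fix e :: real assume "0 < e"
  then obtain N where N: "\<And>k. k \<ge> N \<Longrightarrow> \<bar>s k - L\<bar> < e/2"
    using LIMSEQ_D[OF assms(2), of "e/2"] by auto
  have "\<bar>T n s - L\<bar> < e" if "n \<ge> N" for n
  proof -
    have "T n s \<le> L + e/2" "L - e/2 \<le> T n s"
      using N that by (intro tail_average_le[OF assms(1)] tail_average_ge[OF assms(1)];
        smt (verit) order_trans field_sum_of_halves)+
    then show ?thesis using \<open>0 < e\<close> by linarith
  qed
  then show "\<exists>N. \<forall>n\<ge>N. norm (T n s - L) < e" by auto
qed

lemma tail_average_measurable [measurable (raw)]:
  assumes "tail_average n T" and "\<And>k. f k \<in> borel_measurable M"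
  shows "(\<lambda>\<omega>. T (\<lambda>k. f k \<omega>)) \<in> borel_measurable M"
  using assms by (induction rule: tail_average.induct) auto

lemma tail_average_integral:
  assumes "tail_average n T" and "\<And>k. integrable M (f k)"
  shows "integrable M (\<lambda>\<omega>. T (\<lambda>k. f k \<omega>))"
    and "(LINT \<omega>|M. T (\<lambda>k. f k \<omega>)) = T (\<lambda>k. LINT \<omega>|M. f k \<omega>)"
proof -
  have "integrable M (\<lambda>\<omega>. T (\<lambda>k. f k \<omega>)) \<and>
    (LINT \<omega>|M. T (\<lambda>k. f k \<omega>)) = T (\<lambda>k. LINT \<omega>|M. f k \<omega>)"
    using assms by (induction rule: tail_average.induct) auto
  then show "integrable M (\<lambda>\<omega>. T (\<lambda>k. f k \<omega>))"
    and "(LINT \<omega>|M. T (\<lambda>k. f k \<omega>)) = T (\<lambda>k. LINT \<omega>|M. f k \<omega>)" by auto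
qed

definition convex_functions :: "('a \<Rightarrow> real) set \<Rightarrow> bool" where
  "convex_functions S \<longleftrightarrow>
     (\<forall>X\<in>S. \<forall>Y\<in>S. \<forall>l\<in>{0..1}. (\<lambda>\<omega>. l * X \<omega> + (1 - l) * Y \<omega>) \<in> S)"

lemma tail_average_mem:
  assumes "tail_average n T" and "convex_functions S" and "\<And>k. n \<le> k \<Longrightarrow> f k \<in> S"
  shows "(\<lambda>\<omega>. T (\<lambda>k. f k \<omega>)) \<in> S"
  using assms by (induction rule: tail_average.induct) (auto simp: convex_functions_def)

lemma exp_half_diff_square:
  fixes a b :: real
  shows "(exp (- a/2) - exp (- b/2))\<^sup>2 = exp (- a) + exp (- b) - 2 * exp (- (1/2 * a + (1 - 1/2) * b))"
proof -
  have "exp (- a/2) * exp (- a/2) = exp (- a)" "exp (- b/2) * exp (- b/2) = exp (- b)"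
    "exp (- a/2) * exp (- b/2) = exp (- (1/2 * a + (1 - 1/2) * b))"
    by (simp_all flip: exp_add add: field_simps)
  then show ?thesis by (simp add: power2_eq_square algebra_simps)
qed

text \<open>
The averages are chosen to minimize \<open>E[exp (- T f)]\<close>
almost optimally over the averages of the \<open>n\<close>-th tail. The midpoint of two such averages is a competitor,
so by strict convexity of the exponential
the values of the near minimizers force \<open>exp (- T f / 2)\<close> to be Cauchy in \<open>L\<^sup>2\<close>. Along a
subsequence the averages converge a.e. in \<open>[0, \<infinity>]\<close>, and by Fatou the bound on the
expectations excludes the value \<open>\<infinity>\<close>.
\<close>

lemma (in prob_space) komlos_nonneg:
  fixes f :: "nat \<Rightarrow> 'a \<Rightarrow> real"
  assumes int: "\<And>k. integrable M (f k)" and nonneg: "\<And>k \<omega>. 0 \<le> f k \<omega>"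
    and B: "\<And>k. expectation (f k) \<le> B"
  shows "\<exists>T. (\<forall>n. tail_average n (T n)) \<and>
    (\<exists>g\<in>borel_measurable M. AE \<omega> in M. (\<lambda>n. T n (\<lambda>k. f k \<omega>)) \<longlonglongrightarrow> g \<omega>)"
proof -
  have meas [measurable]: "f k \<in> borel_measurable M" for k using int by auto
  have avg_nonneg: "0 \<le> T (\<lambda>k. f k \<omega>)" if "tail_average n T" for n T \<omega>
    using tail_average_ge[OF that] nonneg by auto
  have avg_meas: "(\<lambda>\<omega>. T (\<lambda>k. f k \<omega>)) \<in> borel_measurable M" if "tail_average n T" for n T
    using tail_average_measurable[OF that meas] .
  have exp_int: "integrable M (\<lambda>\<omega>. exp (- T (\<lambda>k. f k \<omega>)))" if "tail_average n T" for n T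
    using avg_nonneg[OF that] avg_meas[OF that] by (intro integrable_const_bound[where B=1]) auto
  define \<Phi> where "\<Phi> T = expectation (\<lambda>\<omega>. exp (- T (\<lambda>k. f k \<omega>)))" for T :: "(nat \<Rightarrow> real) \<Rightarrow> real"
  define J where "J n = (INF T\<in>{T. tail_average n T}. \<Phi> T)" for n
  have \<Phi>_nonneg: "0 \<le> \<Phi> T" for T unfolding \<Phi>_def by (intro integral_nonneg_AE) auto
  have bdd: "bdd_below (\<Phi> ` {T. tail_average n T})" for n
    using \<Phi>_nonneg by (intro bdd_belowI2)
  have J_le: "J n \<le> \<Phi> T" if "tail_average n T" for n T
    unfolding J_def using bdd that by (intro cINF_lower) auto
  have ne: "{T. tail_average n T} \<noteq> {}" for n using tail_average.point[of n n] by blast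
  have J_mono: "incseq J"
    unfolding J_def by (intro monoI cINF_superset_mono[OF ne bdd])
      (auto intro: tail_average_antimono)
  have J_le1: "J n \<le> 1" for n
  proof -
    have *: "tail_average n (\<lambda>s. s n)" by (intro tail_average.point) simp
    have "\<Phi> (\<lambda>s. s n) \<le> expectation (\<lambda>\<omega>. 1)"
      unfolding \<Phi>_def using nonneg exp_int[OF *] by (intro integral_mono) auto
    then show ?thesis using J_le[OF *] by (simp add: prob_space)
  qed
  have "convergent J"
    using incseq_convergent[OF J_mono, of 1] J_le1 unfolding convergent_def by blast
  have "\<exists>T. tail_average n T \<and> \<Phi> T < J n + 1/Suc n" for n
  proof -
    have "Inf (\<Phi> ` {T. tail_average n T}) < J n + 1/Suc n" unfolding J_def by simp
    then show ?thesis using cInf_lessD[of "\<Phi> ` {T. tail_average n T}"] ne by blast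
  qed
  then obtain T where T: "\<And>n. tail_average n (T n)" and T_min: "\<And>n. \<Phi> (T n) < J n + 1/Suc n"
    by metis
  define h where "h n \<omega> = exp (- T n (\<lambda>k. f k \<omega>)/2)" for n \<omega>
  have h_meas [measurable]: "h n \<in> borel_measurable M" for n
    unfolding h_def using avg_meas[OF T, of n] by measurable
  have h_bounds: "0 < h n \<omega>" "h n \<omega> \<le> 1" for n \<omega>
    using avg_nonneg[OF T, of n \<omega>] by (auto simp: h_def)
  have h_int: "integrable M (h n)" for n
    using h_bounds by (intro integrable_const_bound[where B=1]) (auto simp: less_imp_le)
  \<comment> \<open>Variance is nonnegative, which bounds the \<open>L\<^sup>1\<close> distance by the \<open>L\<^sup>2\<close> distance.\<close>
  have h_close: "(expectation (\<lambda>\<omega>. \<bar>h n \<omega> - h m \<omega>\<bar>))\<^sup>2 \<le> 2 * J (max n m) - 2 * J (min n m) + 1/Suc n + 1/Suc m" for n m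
  proof -
    have b: "\<bar>h n \<omega> - h m \<omega>\<bar> \<le> 1" for \<omega>
      using h_bounds[of n \<omega>] h_bounds[of m \<omega>] by linarith
    then have b2: "(h n \<omega> - h m \<omega>)\<^sup>2 \<le> 1" for \<omega>
      by (simp add: abs_square_le_1)
    let ?mid = "\<lambda>s. 1/2 * T n s + (1 - 1/2) * T m s"
    have mid: "tail_average (min n m) ?mid"
      by (intro tail_average.mix tail_average_antimono[OF T]) auto
    have "(expectation (\<lambda>\<omega>. \<bar>h n \<omega> - h m \<omega>\<bar>))\<^sup>2 \<le> expectation (\<lambda>\<omega>. (h n \<omega> - h m \<omega>)\<^sup>2)"
    proof -
      have i1: "integrable M (\<lambda>\<omega>. \<bar>h n \<omega> - h m \<omega>\<bar>)" using h_int by auto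
      have i2: "integrable M (\<lambda>\<omega>. \<bar>h n \<omega> - h m \<omega>\<bar>\<^sup>2)"
        using b2 by (intro integrable_const_bound[where B=1]) auto
      show ?thesis using variance_positive[of "\<lambda>\<omega>. \<bar>h n \<omega> - h m \<omega>\<bar>"] variance_eq[OF i1 i2] by simp
    qed
    also have "\<dots> = expectation (\<lambda>\<omega>. exp (- T n (\<lambda>k. f k \<omega>)) + exp (- T m (\<lambda>k. f k \<omega>))
        - 2 * exp (- ?mid (\<lambda>k. f k \<omega>)))"
      unfolding h_def exp_half_diff_square ..
    also have "\<dots> = \<Phi> (T n) + \<Phi> (T m) - 2 * \<Phi> ?mid"
      unfolding \<Phi>_def using exp_int[OF T, of n] exp_int[OF T, of m] exp_int[OF mid] by simp
    also have "\<dots> \<le> J n + 1/Suc n + (J m + 1/Suc m) - 2 * J (min n m)"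
      using T_min[of n] T_min[of m] J_le[OF mid] by linarith
    also have "\<dots> \<le> 2 * J (max n m) - 2 * J (min n m) + 1/Suc n + 1/Suc m"
    proof -
      have *: "x + c + (y + d) - 2 * b \<le> 2 * a - 2 * b + c + d"
        if "b \<le> a" "x + y = a + b" for a b c d x y :: real
        using that by (simp add: algebra_simps)
      have "J n + J m = J (max n m) + J (min n m)" by (auto simp: max_def min_def)
      then show ?thesis by (intro *) (auto intro: incseqD[OF J_mono])
    qed
    finally show ?thesis .
  qed
  have cauchy: "\<exists>N. \<forall>i\<ge>N. \<forall>j\<ge>N. (LINT \<omega>|M. norm (h i \<omega> - h j \<omega>)) < e" if "e > 0" for e :: real
  proof -
    from \<open>convergent J\<close> have "Cauchy J" by (rule convergent_Cauchy)
    then obtain N1 where N1: "\<And>i j. i \<ge> N1 \<Longrightarrow> j \<ge> N1 \<Longrightarrow> \<bar>J i - J j\<bar> < e\<^sup>2/8"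
      using CauchyD[of J "e\<^sup>2/8"] \<open>e > 0\<close> by auto
    have "0 < e\<^sup>2/8" using \<open>e > 0\<close> by simp
    then obtain N2 where N2: "1/Suc N2 < e\<^sup>2/8" using nat_approx_posE by blast
    show ?thesis
    proof (intro exI allI impI)
      fix i j assume ij: "max N1 N2 \<le> i" "max N1 N2 \<le> j"
      have "1/Suc i \<le> 1/Suc N2" "1/Suc j \<le> 1/Suc N2"
        using ij by (auto intro!: divide_left_mono)
      moreover have "J (max i j) - J (min i j) < e\<^sup>2/8"
        using N1[of "max i j" "min i j"] ij by linarith
      ultimately have "(expectation (\<lambda>\<omega>. \<bar>h i \<omega> - h j \<omega>\<bar>))\<^sup>2 < e\<^sup>2"
        using h_close[of i j] N2 \<open>0 < e\<^sup>2/8\<close> by linarith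
      then show "(LINT \<omega>|M. norm (h i \<omega> - h j \<omega>)) < e"
        using power_less_imp_less_base[of _ 2 e] \<open>e > 0\<close> by simp
    qed
  qed
  obtain r where r: "strict_mono r" "AE \<omega> in M. Cauchy (\<lambda>i. h (r i) \<omega>)"
    using cauchy_L1_AE_cauchy_subseq[OF h_int cauchy] by blast
  define T' where "T' i = T (r i)" for i
  have T': "tail_average i (T' i)" for i
    unfolding T'_def using tail_average_antimono[OF T strict_mono_imp_increasing[OF r(1)]] .
  define F where "F i \<omega> = T' i (\<lambda>k. f k \<omega>)" for i \<omega>
  have F_meas [measurable]: "F i \<in> borel_measurable M" for i
    unfolding F_def using avg_meas[OF T'] .
  have F_nonneg: "0 \<le> F i \<omega>" for i \<omega> unfolding F_def using avg_nonneg[OF T'] .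
  have F_int: "(\<integral>\<^sup>+\<omega>. ennreal (F i \<omega>) \<partial>M) \<le> ennreal B" for i
  proof -
    note ti = tail_average_integral[OF T'[of i], of M f, OF int]
    have "expectation (F i) \<le> B"
      unfolding F_def ti(2) using B by (intro tail_average_le[OF T'])
    then show ?thesis
      using nn_integral_eq_integral[of M "F i"] ti(1) F_nonneg by (auto simp: F_def[abs_def] intro!: ennreal_leI)
  qed
  have "(\<integral>\<^sup>+\<omega>. liminf (\<lambda>i. ennreal (F i \<omega>)) \<partial>M) \<le> liminf (\<lambda>i. \<integral>\<^sup>+\<omega>. ennreal (F i \<omega>) \<partial>M)"
    by (intro nn_integral_liminf) auto
  also have "\<dots> \<le> liminf (\<lambda>i. ennreal B)"
    using F_int by (intro Liminf_mono) auto
  also have "\<dots> < \<infinity>" by (simp add: Liminf_const)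
  finally have fin: "AE \<omega> in M. liminf (\<lambda>i. ennreal (F i \<omega>)) \<noteq> \<infinity>"
    by (intro nn_integral_PInf_AE) auto
  have conv: "AE \<omega> in M. convergent (\<lambda>i. F i \<omega>)"
    using r(2) fin
  proof eventually_elim
    case (elim \<omega>)
    then obtain x where x: "(\<lambda>i. h (r i) \<omega>) \<longlonglongrightarrow> x"
      using Cauchy_convergent convergent_def by blast
    have F_ln: "F i \<omega> = - 2 * ln (h (r i) \<omega>)" for i
      by (simp add: F_def T'_def h_def)
    have "x \<noteq> 0"
    proof
      assume "x = 0"
      then have "filterlim (\<lambda>i. h (r i) \<omega>) (at_right 0) sequentially"
        using x h_bounds by (intro tendsto_imp_filterlim_at_right) auto
      then have "filterlim (\<lambda>i. ln (h (r i) \<omega>)) at_bot sequentially"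
        by (rule filterlim_compose[OF ln_at_0])
      then have "filterlim (\<lambda>i. F i \<omega>) at_top sequentially"
        using filterlim_tendsto_pos_mult_at_top[OF tendsto_const, of 2 "\<lambda>i. - ln (h (r i) \<omega>)"]
        unfolding F_ln filterlim_uminus_at_bot by simp
      then have "((\<lambda>i. ennreal (F i \<omega>)) \<longlongrightarrow> top) sequentially"
        by (simp add: ennreal_tendsto_top_eq_at_top)
      then have "liminf (\<lambda>i. ennreal (F i \<omega>)) = \<infinity>"
        by (simp add: lim_imp_Liminf)
      then show False using elim by simp
    qed
    then have "(\<lambda>i. - 2 * ln (h (r i) \<omega>)) \<longlonglongrightarrow> - 2 * ln x"
      using x by (intro tendsto_intros)
    then show ?case unfolding F_ln convergent_def by blast
  qed
  show ?thesis
  proof (intro exI[of _ T'] conjI allI T' bexI[of _ "\<lambda>\<omega>. lim (\<lambda>i. F i \<omega>)"])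
    show "(\<lambda>\<omega>. lim (\<lambda>i. F i \<omega>)) \<in> borel_measurable M" by measurable
    show "AE \<omega> in M. (\<lambda>n. T' n (\<lambda>k. f k \<omega>)) \<longlonglongrightarrow> lim (\<lambda>i. F i \<omega>)"
      using conv by eventually_elim (simp add: convergent_LIMSEQ_iff F_def)
  qed
qed

lemma (in prob_space) komlos:
  fixes f :: "nat \<Rightarrow> 'a \<Rightarrow> real"
  assumes int: "\<And>k. integrable M (f k)" and c: "\<And>k. AE \<omega> in M. c \<le> f k \<omega>"
    and B: "\<And>k. expectation (f k) \<le> B"
  shows "\<exists>T. (\<forall>n. tail_average n (T n)) \<and>
    (\<exists>g\<in>borel_measurable M. AE \<omega> in M. (\<lambda>n. T n (\<lambda>k. f k \<omega>)) \<longlonglongrightarrow> g \<omega>)"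
proof -
  define f' where "f' k \<omega> = max 0 (f k \<omega> - c)" for k \<omega>
  have ae: "AE \<omega> in M. \<forall>k. f' k \<omega> = f k \<omega> - c"
    unfolding AE_all_countable using c by (auto simp: f'_def max_def elim!: eventually_mono)
  have i: "integrable M (f' k)" for k unfolding f'_def using int by (intro integrable_max) auto
  have "expectation (f' k) = expectation (\<lambda>\<omega>. f k \<omega> - c)" for k
    using ae int i by (intro integral_cong_AE) (auto elim: eventually_mono)
  then have b: "expectation (f' k) \<le> B - c" for k using B[of k] int by (simp add: prob_space)
  obtain T g where T: "\<And>n. tail_average n (T n)" and g: "g \<in> borel_measurable M"
    "AE \<omega> in M. (\<lambda>n. T n (\<lambda>k. f' k \<omega>)) \<longlonglongrightarrow> g \<omega>"
    using komlos_nonneg[of f' "B - c"] i b by (auto simp: f'_def)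
  show ?thesis
  proof (intro exI[of _ T] conjI allI T bexI[of _ "\<lambda>\<omega>. g \<omega> + c"])
    show "(\<lambda>\<omega>. g \<omega> + c) \<in> borel_measurable M" using g by measurable
    show "AE \<omega> in M. (\<lambda>n. T n (\<lambda>k. f k \<omega>)) \<longlonglongrightarrow> g \<omega> + c"
      using ae g(2)
    proof eventually_elim
      case (elim \<omega>)
      then have "f k \<omega> = f' k \<omega> + c" for k by simp
      then have "T n (\<lambda>k. f k \<omega>) = T n (\<lambda>k. f' k \<omega>) + c" for n
        using tail_average_add_const[OF T] by simp
      then show ?case using elim by (auto intro!: tendsto_intros)
    qed
  qed
qed

section \<open>The Hahn-Banach theorem for spaces of functions\<close>

text \<open>
Bounded functions modulo a measure form a set of functions, not a type; linear structure is
therefore expressed relative to a carrier set.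
\<close>

definition function_space :: "('a \<Rightarrow> real) set \<Rightarrow> bool" where
  "function_space V \<longleftrightarrow>
     (\<lambda>_. 0) \<in> V \<and> (\<forall>X\<in>V. \<forall>Y\<in>V. \<forall>a b. (\<lambda>\<omega>. a * X \<omega> + b * Y \<omega>) \<in> V)"

text \<open>
Only the inequality is required in the homogeneity clause: it is easier to establish for infima, and
the equality follows by scaling back.
\<close>

definition sublinear_on :: "('a \<Rightarrow> real) set \<Rightarrow> (('a \<Rightarrow> real) \<Rightarrow> real) \<Rightarrow> bool" where
  "sublinear_on V q \<longleftrightarrow> q (\<lambda>_. 0) = 0 \<and>
     (\<forall>X\<in>V. \<forall>Y\<in>V. q (\<lambda>\<omega>. X \<omega> + Y \<omega>) \<le> q X + q Y) \<and>
     (\<forall>X\<in>V. \<forall>a>0. q (\<lambda>\<omega>. a * X \<omega>) \<le> a * q X)"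

lemma function_space_closed:
  assumes "function_space V" "X \<in> V" "Y \<in> V"
  shows "(\<lambda>\<omega>. a * X \<omega> + b * Y \<omega>) \<in> V" "(\<lambda>\<omega>. X \<omega> + Y \<omega>) \<in> V" "(\<lambda>\<omega>. X \<omega> + b * Y \<omega>) \<in> V"
    "(\<lambda>\<omega>. X \<omega> - Y \<omega>) \<in> V" "(\<lambda>\<omega>. a * X \<omega>) \<in> V" "(\<lambda>\<omega>. - X \<omega>) \<in> V"
proof -
  have *: "(\<lambda>\<omega>. a * X \<omega> + b * Y \<omega>) \<in> V" for a b using assms by (auto simp: function_space_def)
  show "(\<lambda>\<omega>. a * X \<omega> + b * Y \<omega>) \<in> V" "(\<lambda>\<omega>. X \<omega> + Y \<omega>) \<in> V" "(\<lambda>\<omega>. X \<omega> + b * Y \<omega>) \<in> V"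
    "(\<lambda>\<omega>. X \<omega> - Y \<omega>) \<in> V" "(\<lambda>\<omega>. a * X \<omega>) \<in> V" "(\<lambda>\<omega>. - X \<omega>) \<in> V"
    using *[of a b] *[of 1 1] *[of 1 b] *[of 1 "-1"] *[of a 0] *[of "-1" 0] by auto
qed

lemma sublinear_on_scale:
  assumes "sublinear_on V q" "function_space V" "X \<in> V" "0 \<le> a"
  shows "q (\<lambda>\<omega>. a * X \<omega>) = a * q X"
proof (cases "a = 0")
  case False
  then have a: "0 < a" using assms by simp
  have "q (\<lambda>\<omega>. (1/a) * (a * X \<omega>)) \<le> (1/a) * q (\<lambda>\<omega>. a * X \<omega>)"
    using assms a function_space_closed(5)[OF assms(2,3,3), of a] unfolding sublinear_on_def
    by (meson zero_less_divide_1_iff)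
  then have "a * q X \<le> q (\<lambda>\<omega>. a * X \<omega>)" using a by (simp add: field_simps)
  moreover have "q (\<lambda>\<omega>. a * X \<omega>) \<le> a * q X" using assms a by (auto simp: sublinear_on_def)
  ultimately show ?thesis by simp
qed (use assms in \<open>auto simp: sublinear_on_def\<close>)

lemma sublinear_on_lower:
  assumes "sublinear_on V q" "function_space V" "X \<in> V" "Y \<in> V"
  shows "q Y - q (\<lambda>\<omega>. - X \<omega>) \<le> q (\<lambda>\<omega>. X \<omega> + Y \<omega>)"
proof -
  have "q (\<lambda>\<omega>. (X \<omega> + Y \<omega>) + (- X \<omega>)) \<le> q (\<lambda>\<omega>. X \<omega> + Y \<omega>) + q (\<lambda>\<omega>. - X \<omega>)"
    using assms(1) function_space_closed(2)[OF assms(2-4)] function_space_closed(6)[OF assms(2,3,3)]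
    by (simp only: sublinear_on_def)
  then show ?thesis by simp
qed

lemma sublinear_on_opposite:
  assumes "sublinear_on V q" "function_space V" "X \<in> V"
  shows "- q (\<lambda>\<omega>. - X \<omega>) \<le> q X"
proof -
  have "(\<lambda>_. 0) \<in> V" using assms by (simp add: function_space_def)
  from sublinear_on_lower[OF assms this] show ?thesis
    using assms by (simp add: sublinear_on_def)
qed

text \<open>
The pointwise infimum of a chain of sublinear functionals is sublinear, and it is finite because each
member satisfies \<open>- q (- X) \<le> - p (- X) \<le> p X\<close>. Functionals are set to zero off \<open>V\<close> so that
the pointwise order is antisymmetric.
\<close>

lemma minimal_sublinear:
  assumes V: "function_space V" and q: "sublinear_on V q"
  obtains p where "sublinear_on V p" "\<And>X. X \<in> V \<Longrightarrow> p X \<le> q X"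
    "\<And>p' X. sublinear_on V p' \<Longrightarrow> (\<And>X. X \<in> V \<Longrightarrow> p' X \<le> p X) \<Longrightarrow> X \<in> V \<Longrightarrow> p' X = p X"
proof -
  define A where "A = {p. sublinear_on V p \<and> (\<forall>X\<in>V. p X \<le> q X) \<and> (\<forall>X. X \<notin> V \<longrightarrow> p X = 0)}"
  define ge where "ge p p' \<longleftrightarrow> (\<forall>X. p' X \<le> p X)" for p p' :: "('a \<Rightarrow> real) \<Rightarrow> real"
  have restrict: "sublinear_on V (\<lambda>X. if X \<in> V then p X else 0)" if "sublinear_on V p" for p
    using that function_space_closed[OF V] V unfolding sublinear_on_def function_space_def by auto
  have po: "partial_order_on A (relation_of ge A)"
  proof (rule partial_order_on_relation_ofI)
    show "ge p p''" if "ge p p'" "ge p' p''" for p p' p''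
      using that unfolding ge_def by (meson order_trans)
    show "p = p'" if "ge p p'" "ge p' p" for p p'
      using that unfolding ge_def by (intro ext antisym) auto
  qed (simp add: ge_def)
  have "\<exists>m\<in>A. \<forall>p\<in>A. ge m p \<longrightarrow> p = m"
  proof (rule predicate_Zorn[OF po])
    fix C assume "C \<in> Chains (relation_of ge A)"
    then have CA: "C \<subseteq> A" and total: "\<And>p p'. p \<in> C \<Longrightarrow> p' \<in> C \<Longrightarrow> ge p p' \<or> ge p' p"
      by (auto simp: Chains_def relation_of_def)
    show "\<exists>u\<in>A. \<forall>p\<in>C. ge p u"
    proof (cases "C = {}")
      case True
      have "(\<lambda>X. if X \<in> V then q X else 0) \<in> A" using restrict[OF q] by (auto simp: A_def)
      then show ?thesis using True by auto
    next
      case False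
      define u where "u X = (INF p\<in>C. p X)" for X
      have bdd: "bdd_below ((\<lambda>p. p X) ` C)" if "X \<in> V" for X
      proof (rule bdd_belowI2)
        fix p assume "p \<in> C"
        then have p: "sublinear_on V p" "p (\<lambda>\<omega>. - X \<omega>) \<le> q (\<lambda>\<omega>. - X \<omega>)"
          using CA function_space_closed(6)[OF V that that] by (auto simp: A_def)
        then show "- q (\<lambda>\<omega>. - X \<omega>) \<le> p X" using sublinear_on_opposite[OF p(1) V that] by simp
      qed
      have u_le: "u X \<le> p X" if "p \<in> C" "X \<in> V" for p X
        unfolding u_def using that bdd by (intro cINF_lower)
      have u_ge: "c \<le> u X" if "\<And>p. p \<in> C \<Longrightarrow> c \<le> p X" for c X
        unfolding u_def using that False by (intro cINF_greatest)
      have u0: "u (\<lambda>_. 0) = 0"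
        unfolding u_def using CA False by (subst INF_cong[of C C _ "\<lambda>_. 0"]) (auto simp: A_def sublinear_on_def)
      have "sublinear_on V u" unfolding sublinear_on_def
      proof (intro conjI ballI allI impI u0)
        fix X Y assume XY: "X \<in> V" "Y \<in> V"
        have *: "u (\<lambda>\<omega>. X \<omega> + Y \<omega>) \<le> p1 X + p2 Y" if pC: "p1 \<in> C" "p2 \<in> C" for p1 p2
        proof -
          obtain p where p: "p \<in> C" "p X \<le> p1 X" "p Y \<le> p2 Y"
            using total[OF pC] pC unfolding ge_def by (meson order_refl)
          then have "sublinear_on V p" using CA by (auto simp: A_def)
          then have "p (\<lambda>\<omega>. X \<omega> + Y \<omega>) \<le> p X + p Y" using XY by (auto simp: sublinear_on_def)
          then show ?thesis using p u_le[OF p(1) function_space_closed(2)[OF V XY]] by simp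
        qed
        then have "u (\<lambda>\<omega>. X \<omega> + Y \<omega>) - p1 X \<le> u Y" if "p1 \<in> C" for p1
          using *[OF that] by (intro u_ge) (simp add: diff_le_eq add.commute)
        then have "u (\<lambda>\<omega>. X \<omega> + Y \<omega>) - u Y \<le> u X"
          by (intro u_ge) (simp add: algebra_simps)
        then show "u (\<lambda>\<omega>. X \<omega> + Y \<omega>) \<le> u X + u Y" by simp
      next
        fix X and a :: real assume X: "X \<in> V" "0 < a"
        have "u (\<lambda>\<omega>. a * X \<omega>) / a \<le> u X"
        proof (rule u_ge)
          fix p assume "p \<in> C"
          then have "p (\<lambda>\<omega>. a * X \<omega>) \<le> a * p X" using CA X by (auto simp: A_def sublinear_on_def)
          then show "u (\<lambda>\<omega>. a * X \<omega>) / a \<le> p X"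
            using u_le[OF \<open>p \<in> C\<close> function_space_closed(5)[OF V X(1) X(1)], of a] X(2) by (simp add: field_simps)
        qed
        then show "u (\<lambda>\<omega>. a * X \<omega>) \<le> a * u X" using X(2) by (simp add: field_simps)
      qed
      moreover have "u X \<le> q X" if "X \<in> V" for X
      proof -
        obtain p where "p \<in> C" using False by blast
        then show ?thesis using u_le[of p X] that CA by (force simp: A_def)
      qed
      ultimately have "(\<lambda>X. if X \<in> V then u X else 0) \<in> A" using restrict by (auto simp: A_def)
      moreover have "ge p (\<lambda>X. if X \<in> V then u X else 0)" if "p \<in> C" for p
        using u_le[OF that] CA that by (auto simp: ge_def A_def)
      ultimately show ?thesis by blast
    qed
  qed
  then obtain p where p: "p \<in> A" and min: "\<And>p'. p' \<in> A \<Longrightarrow> ge p p' \<Longrightarrow> p' = p" by blast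
  show thesis
  proof (rule that)
    show "sublinear_on V p" and "\<And>X. X \<in> V \<Longrightarrow> p X \<le> q X" using p by (auto simp: A_def)
    fix p' X assume p': "sublinear_on V p'" "\<And>X. X \<in> V \<Longrightarrow> p' X \<le> p X" and "X \<in> V"
    have "(\<lambda>X. if X \<in> V then p' X else 0) \<in> A"
      using restrict[OF p'(1)] p'(2) p by (force simp: A_def)
    moreover have "ge p (\<lambda>X. if X \<in> V then p' X else 0)" using p p'(2) by (auto simp: ge_def A_def)
    ultimately have "(\<lambda>X. if X \<in> V then p' X else 0) = p" by (rule min)
    then show "p' X = p X" using \<open>X \<in> V\<close> by (metis (mono_tags))
  qed
qed

text \<open>
A minimal sublinear functional \<open>p\<close> is linear: for fixed \<open>Y\<close>, the functional
\<open>X \<mapsto> inf\<^sub>t (p (X + t Y) - t p Y)\<close> is sublinear and lies below \<open>p\<close>, so it equals \<open>p\<close>; the choice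
\<open>t = 1\<close> then gives superadditivity.
\<close>

lemma hahn_banach_dominated:
  assumes V: "function_space V" and q: "sublinear_on V q"
  obtains l where "\<And>X. X \<in> V \<Longrightarrow> l X \<le> q X"
    "\<And>X Y a b. X \<in> V \<Longrightarrow> Y \<in> V \<Longrightarrow> l (\<lambda>\<omega>. a * X \<omega> + b * Y \<omega>) = a * l X + b * l Y"
proof -
  obtain p where p: "sublinear_on V p" and pq: "\<And>X. X \<in> V \<Longrightarrow> p X \<le> q X"
    and min: "\<And>p' X. sublinear_on V p' \<Longrightarrow> (\<And>X. X \<in> V \<Longrightarrow> p' X \<le> p X) \<Longrightarrow> X \<in> V \<Longrightarrow> p' X = p X"
    using minimal_sublinear[OF V q] by blast
  note cl = function_space_closed[OF V]
  have p_add: "p (\<lambda>\<omega>. X \<omega> + Y \<omega>) \<le> p X + p Y" if "X \<in> V" "Y \<in> V" for X Y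
    using p that by (auto simp: sublinear_on_def)
  have p0: "p (\<lambda>_. 0) = 0" using p by (auto simp: sublinear_on_def)
  have zero: "(\<lambda>_. 0) \<in> V" using V by (simp add: function_space_def)
  note scale = sublinear_on_scale[OF p V]
  have super: "p X + p Y \<le> p (\<lambda>\<omega>. X \<omega> + Y \<omega>)" if X: "X \<in> V" and Y: "Y \<in> V" for X Y
  proof -
    define r where "r X = (INF t\<in>{0..}. p (\<lambda>\<omega>. X \<omega> + t * Y \<omega>) - t * p Y)" for X
    have bdd: "bdd_below ((\<lambda>t. p (\<lambda>\<omega>. X \<omega> + t * Y \<omega>) - t * p Y) ` {0..})" if "X \<in> V" for X
    proof (rule bdd_belowI2)
      fix t :: real assume "t \<in> {0..}"
      then show "- p (\<lambda>\<omega>. - X \<omega>) \<le> p (\<lambda>\<omega>. X \<omega> + t * Y \<omega>) - t * p Y"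
        using sublinear_on_lower[OF p V that cl(5)[OF Y Y, of t]] scale[OF Y, of t] by simp
    qed
    have r_le: "r X \<le> p (\<lambda>\<omega>. X \<omega> + t * Y \<omega>) - t * p Y" if "X \<in> V" "0 \<le> t" for X t
      unfolding r_def using that bdd by (intro cINF_lower) auto
    have r_ge: "c \<le> r X" if "\<And>t. 0 \<le> t \<Longrightarrow> c \<le> p (\<lambda>\<omega>. X \<omega> + t * Y \<omega>) - t * p Y" for c X
      unfolding r_def using that by (intro cINF_greatest) auto
    have r_le_p: "r X \<le> p X" if "X \<in> V" for X using r_le[OF that, of 0] by simp
    have "sublinear_on V r" unfolding sublinear_on_def
    proof (intro conjI ballI allI impI)
      show "r (\<lambda>_. 0) = 0"
        using r_le_p[OF zero] r_ge[of 0 "\<lambda>_. 0"] scale[OF Y] p0 by (intro antisym) auto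
    next
      fix X Z assume XZ: "X \<in> V" "Z \<in> V"
      have *: "r (\<lambda>\<omega>. X \<omega> + Z \<omega>) \<le> (p (\<lambda>\<omega>. X \<omega> + t * Y \<omega>) - t * p Y) + (p (\<lambda>\<omega>. Z \<omega> + s * Y \<omega>) - s * p Y)"
        if ts: "0 \<le> t" "0 \<le> s" for t s
      proof -
        have "(\<lambda>\<omega>. (X \<omega> + Z \<omega>) + (t + s) * Y \<omega>) = (\<lambda>\<omega>. (X \<omega> + t * Y \<omega>) + (Z \<omega> + s * Y \<omega>))"
          by (auto simp: algebra_simps)
        then have "p (\<lambda>\<omega>. (X \<omega> + Z \<omega>) + (t + s) * Y \<omega>) \<le> p (\<lambda>\<omega>. X \<omega> + t * Y \<omega>) + p (\<lambda>\<omega>. Z \<omega> + s * Y \<omega>)"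
          using p_add[OF cl(3)[OF XZ(1) Y, of t] cl(3)[OF XZ(2) Y, of s]] by simp
        then show ?thesis using r_le[OF cl(2)[OF XZ], of "t + s"] ts by (simp add: algebra_simps)
      qed
      then have "r (\<lambda>\<omega>. X \<omega> + Z \<omega>) - (p (\<lambda>\<omega>. X \<omega> + t * Y \<omega>) - t * p Y) \<le> r Z" if "0 \<le> t" for t
        using that by (intro r_ge) (simp add: diff_le_eq add.commute)
      then have "r (\<lambda>\<omega>. X \<omega> + Z \<omega>) - r Z \<le> r X"
        by (intro r_ge) (simp add: algebra_simps)
      then show "r (\<lambda>\<omega>. X \<omega> + Z \<omega>) \<le> r X + r Z" by simp
    next
      fix X and a :: real assume X: "X \<in> V" "0 < a"
      have "r (\<lambda>\<omega>. a * X \<omega>) / a \<le> r X"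
      proof (rule r_ge)
        fix t :: real assume t: "0 \<le> t"
        have "(\<lambda>\<omega>. a * X \<omega> + (a * t) * Y \<omega>) = (\<lambda>\<omega>. a * (X \<omega> + t * Y \<omega>))" by (auto simp: algebra_simps)
        then have "p (\<lambda>\<omega>. a * X \<omega> + (a * t) * Y \<omega>) = a * p (\<lambda>\<omega>. X \<omega> + t * Y \<omega>)"
          using scale[OF cl(3)[OF X(1) Y, of t], of a] X(2) by simp
        then have "r (\<lambda>\<omega>. a * X \<omega>) \<le> a * (p (\<lambda>\<omega>. X \<omega> + t * Y \<omega>) - t * p Y)"
          using r_le[OF cl(5)[OF X(1) X(1), of a], of "a * t"] t X(2) by (simp add: algebra_simps)
        then show "r (\<lambda>\<omega>. a * X \<omega>) / a \<le> p (\<lambda>\<omega>. X \<omega> + t * Y \<omega>) - t * p Y"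
          using X(2) by (simp add: field_simps)
      qed
      then show "r (\<lambda>\<omega>. a * X \<omega>) \<le> a * r X" using X(2) by (simp add: field_simps)
    qed
    then have "r X = p X" using min r_le_p X by blast
    then show ?thesis using r_le[OF X, of 1] by simp
  qed
  have add: "p (\<lambda>\<omega>. X \<omega> + Y \<omega>) = p X + p Y" if "X \<in> V" "Y \<in> V" for X Y
    using super[OF that] p_add[OF that] by simp
  have hom: "p (\<lambda>\<omega>. a * X \<omega>) = a * p X" if X: "X \<in> V" for a X
  proof (cases "0 \<le> a")
    case False
    have "p (\<lambda>\<omega>. a * X \<omega> + (- a) * X \<omega>) = p (\<lambda>\<omega>. a * X \<omega>) + p (\<lambda>\<omega>. (- a) * X \<omega>)"
      by (intro add cl(5)[OF X X])
    then show ?thesis using scale[OF X, of "- a"] False p0 by simp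
  qed (use scale[OF X] in auto)
  show thesis
    using that[of p] pq add[OF cl(5) cl(5)] hom by (metis (no_types, lifting))
qed

section \<open>Bounded convex sets closed under a.e. limits\<close>

lemma Linf_function_space: "function_space (Linf \<mu>)"
  unfolding function_space_def
proof (intro conjI ballI allI)
  show "(\<lambda>_. 0) \<in> Linf \<mu>" by (auto simp: Linf_def)
  fix X Y :: "'a \<Rightarrow> real" and a b :: real
  assume XY: "X \<in> Linf \<mu>" "Y \<in> Linf \<mu>"
  then obtain c d where c: "AE \<omega> in \<mu>. \<bar>X \<omega>\<bar> \<le> c" and d: "AE \<omega> in \<mu>. \<bar>Y \<omega>\<bar> \<le> d"
    by (auto simp: Linf_def)
  have "AE \<omega> in \<mu>. \<bar>a * X \<omega> + b * Y \<omega>\<bar> \<le> \<bar>a\<bar> * c + \<bar>b\<bar> * d"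
    using c d
  proof eventually_elim
    case (elim \<omega>)
    have "\<bar>a * X \<omega> + b * Y \<omega>\<bar> \<le> \<bar>a\<bar> * \<bar>X \<omega>\<bar> + \<bar>b\<bar> * \<bar>Y \<omega>\<bar>"
      using abs_triangle_ineq[of "a * X \<omega>" "b * Y \<omega>"] by (simp add: abs_mult)
    also have "\<dots> \<le> \<bar>a\<bar> * c + \<bar>b\<bar> * d" using elim by (intro add_mono mult_left_mono) auto
    finally show ?case .
  qed
  then show "(\<lambda>\<omega>. a * X \<omega> + b * Y \<omega>) \<in> Linf \<mu>" using XY by (auto simp: Linf_def)
qed

lemmas Linf_closed = function_space_closed[OF Linf_function_space]

lemma Linf_const: "(\<lambda>_. c) \<in> Linf \<mu>" by (auto simp: Linf_def)

lemma Linf_indicator: "A \<in> sets \<mu> \<Longrightarrow> indicator A \<in> Linf \<mu>"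
  by (auto simp: Linf_def indicator_def intro!: exI[of _ 1])

lemma Linf_convex: "convex_functions (Linf \<mu>)"
  unfolding convex_functions_def using Linf_closed(1) by blast

lemma (in prob_space) Linf_integrable: "X \<in> Linf M \<Longrightarrow> integrable M X"
  unfolding Linf_def using integrable_const_bound[of X] by auto

lemma closed_under_ae_convergenceD:
  assumes "closed_under_ae_convergence \<mu> S" "\<And>n. Gs n \<in> S" "G \<in> borel_measurable \<mu>"
    "AE \<omega> in \<mu>. (\<lambda>n. Gs n \<omega>) \<longlonglongrightarrow> G \<omega>"
  shows "G \<in> S"
  using assms unfolding closed_under_ae_convergence_def by blast

definition bounded_closed_convex :: "'a measure \<Rightarrow> ('a \<Rightarrow> real) set \<Rightarrow> bool" where
  "bounded_closed_convex \<mu> S \<longleftrightarrow> S \<subseteq> borel_measurable \<mu> \<and> convex_functions S \<and>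
     closed_under_ae_convergence \<mu> S \<and> (\<exists>c. \<forall>X\<in>S. AE \<omega> in \<mu>. \<bar>X \<omega>\<bar> \<le> c)"

lemma bounded_closed_convex_subset_Linf: "bounded_closed_convex \<mu> S \<Longrightarrow> S \<subseteq> Linf \<mu>"
  unfolding bounded_closed_convex_def Linf_def by blast

text \<open>
This is the substitute for weak-star compactness of bounded closed convex sets.
\<close>

lemma (in prob_space) bounded_closed_convex_komlos:
  assumes S: "bounded_closed_convex M S" and Z: "\<And>n. Z n \<in> S"
  shows "\<exists>T. (\<forall>n. tail_average n (T n)) \<and>
    (\<exists>Z'\<in>S. AE \<omega> in M. (\<lambda>n. T n (\<lambda>k. Z k \<omega>)) \<longlonglongrightarrow> Z' \<omega>)"
proof -
  obtain c where c: "\<And>X. X \<in> S \<Longrightarrow> AE \<omega> in M. \<bar>X \<omega>\<bar> \<le> c"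
    using S by (auto simp: bounded_closed_convex_def)
  have int: "integrable M (Z n)" for n
    using Z bounded_closed_convex_subset_Linf[OF S] Linf_integrable by blast
  have lower: "AE \<omega> in M. - c \<le> Z n \<omega>" for n using c[OF Z, of n] by (auto elim!: eventually_mono)
  have "expectation (Z n) \<le> expectation (\<lambda>_. c)" for n
    using c[OF Z, of n] int by (intro integral_mono_AE) (auto elim!: eventually_mono)
  then have "expectation (Z n) \<le> c" for n by (simp add: prob_space)
  with komlos[of Z "- c" c] int lower obtain T Z' where T: "\<And>n. tail_average n (T n)"
    and Z': "Z' \<in> borel_measurable M" "AE \<omega> in M. (\<lambda>n. T n (\<lambda>k. Z k \<omega>)) \<longlonglongrightarrow> Z' \<omega>"
    by auto
  have "(\<lambda>\<omega>. T n (\<lambda>k. Z k \<omega>)) \<in> S" for n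
    using tail_average_mem[OF T[of n], of S Z] S Z by (simp add: bounded_closed_convex_def)
  moreover have "closed_under_ae_convergence M S" using S by (simp add: bounded_closed_convex_def)
  ultimately have "Z' \<in> S"
    using Z' closed_under_ae_convergenceD[of M S "\<lambda>n \<omega>. T n (\<lambda>k. Z k \<omega>)" Z'] by blast
  with T Z'(2) show ?thesis by blast
qed

definition small_functions :: "'a measure \<Rightarrow> real \<Rightarrow> ('a \<Rightarrow> real) set" where
  "small_functions \<mu> e =
     {f \<in> borel_measurable \<mu>. (AE \<omega> in \<mu>. 0 \<le> f \<omega> \<and> f \<omega> \<le> 1) \<and> (LINT \<omega>|\<mu>. f \<omega>) \<le> e}"

definition lower_by_small :: "'a measure \<Rightarrow> real \<Rightarrow> ('a \<Rightarrow> real) set \<Rightarrow> ('a \<Rightarrow> real) set" where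
  "lower_by_small \<mu> e S = {\<lambda>\<omega>. Z \<omega> - f \<omega> |Z f. Z \<in> S \<and> f \<in> small_functions \<mu> e}"

lemma lower_by_smallI:
  "Z \<in> S \<Longrightarrow> f \<in> small_functions \<mu> e \<Longrightarrow> (\<lambda>\<omega>. Z \<omega> - f \<omega>) \<in> lower_by_small \<mu> e S"
  unfolding lower_by_small_def by blast

lemma lower_by_small_superset: "0 \<le> e \<Longrightarrow> S \<subseteq> lower_by_small \<mu> e S"
proof
  fix Z assume "0 \<le> e" "Z \<in> S"
  moreover have "(\<lambda>_. 0) \<in> small_functions \<mu> e" using \<open>0 \<le> e\<close> by (auto simp: small_functions_def)
  ultimately show "Z \<in> lower_by_small \<mu> e S"
    unfolding lower_by_small_def by (intro CollectI exI[of _ Z] exI[of _ "\<lambda>_. 0"]) auto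
qed

lemma (in prob_space) small_functions_integrable:
  assumes "f \<in> small_functions M e" shows "integrable M f"
proof (rule integrable_const_bound[where B=1])
  have "AE \<omega> in M. 0 \<le> f \<omega> \<and> f \<omega> \<le> 1" using assms by (simp add: small_functions_def)
  then show "AE \<omega> in M. norm (f \<omega>) \<le> 1" by eventually_elim simp
qed (use assms in \<open>simp add: small_functions_def\<close>)

lemma (in prob_space) small_functions_convex: "convex_functions (small_functions M e)"
  unfolding convex_functions_def
proof (intro ballI)
  fix f g and l :: real assume fg: "f \<in> small_functions M e" "g \<in> small_functions M e" and l: "l \<in> {0..1}"
  have "AE \<omega> in M. 0 \<le> f \<omega> \<and> f \<omega> \<le> 1" "AE \<omega> in M. 0 \<le> g \<omega> \<and> g \<omega> \<le> 1"
    using fg by (auto simp: small_functions_def)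
  then have "AE \<omega> in M. 0 \<le> l * f \<omega> + (1 - l) * g \<omega> \<and> l * f \<omega> + (1 - l) * g \<omega> \<le> 1"
  proof eventually_elim
    case (elim \<omega>)
    then show ?case using l by (auto intro!: convex_bound_le)
  qed
  moreover have "expectation (\<lambda>\<omega>. l * f \<omega> + (1 - l) * g \<omega>) = l * expectation f + (1 - l) * expectation g"
    using fg[THEN small_functions_integrable] by simp
  moreover have "l * expectation f + (1 - l) * expectation g \<le> e"
    using fg l by (intro convex_bound_le) (auto simp: small_functions_def)
  ultimately show "(\<lambda>\<omega>. l * f \<omega> + (1 - l) * g \<omega>) \<in> small_functions M e"
    using fg by (auto simp: small_functions_def)
qed

text \<open>
If \<open>Z\<^sub>n - f\<^sub>n\<close> converges, averages of the \<open>Z\<^sub>n\<close> converge in \<open>S\<close>, hence the same averages of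
the \<open>f\<^sub>n\<close> converge as well, and bounded convergence keeps their limit in the set of small functions.
\<close>

lemma (in prob_space) lower_by_small_closed:
  assumes S: "bounded_closed_convex M S"
  shows "closed_under_ae_convergence M (lower_by_small M e S)"
  unfolding closed_under_ae_convergence_def
proof (intro allI impI)
  fix Ys Y assume Ys: "\<forall>n. Ys n \<in> lower_by_small M e S" and Y: "Y \<in> borel_measurable M"
    and lim: "AE \<omega> in M. (\<lambda>n. Ys n \<omega>) \<longlonglongrightarrow> Y \<omega>"
  have "\<exists>p. fst p \<in> S \<and> snd p \<in> small_functions M e \<and> Ys n = (\<lambda>\<omega>. fst p \<omega> - snd p \<omega>)" for n
    using Ys[rule_format, of n] unfolding lower_by_small_def by auto
  then obtain p where p: "\<And>n. fst (p n) \<in> S \<and> snd (p n) \<in> small_functions M e \<and>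
      Ys n = (\<lambda>\<omega>. fst (p n) \<omega> - snd (p n) \<omega>)" using choice by meson
  define Z f where "Z n = fst (p n)" and "f n = snd (p n)" for n
  have Z: "\<And>n. Z n \<in> S" and f: "\<And>n. f n \<in> small_functions M e"
    and Ys_eq: "\<And>n. Ys n = (\<lambda>\<omega>. Z n \<omega> - f n \<omega>)" using p by (auto simp: Z_def f_def)
  obtain T Z' where T: "\<And>n. tail_average n (T n)" and Z': "Z' \<in> S"
    and limZ: "AE \<omega> in M. (\<lambda>n. T n (\<lambda>k. Z k \<omega>)) \<longlonglongrightarrow> Z' \<omega>"
    using bounded_closed_convex_komlos[OF S, of Z] Z by auto
  have Z'm: "Z' \<in> borel_measurable M" using Z' S by (auto simp: bounded_closed_convex_def)
  have Tf: "(\<lambda>\<omega>. T n (\<lambda>k. f k \<omega>)) \<in> small_functions M e" for n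
    by (intro tail_average_mem[OF T small_functions_convex] f)
  have limf: "AE \<omega> in M. (\<lambda>n. T n (\<lambda>k. f k \<omega>)) \<longlonglongrightarrow> Z' \<omega> - Y \<omega>"
    using limZ lim
  proof eventually_elim
    case (elim \<omega>)
    have "(\<lambda>n. T n (\<lambda>k. Z k \<omega>) - T n (\<lambda>k. Ys k \<omega>)) \<longlonglongrightarrow> Z' \<omega> - Y \<omega>"
      by (intro tendsto_diff elim(1) tail_average_tendsto[OF T elim(2)])
    moreover have "T n (\<lambda>k. Z k \<omega>) - T n (\<lambda>k. Ys k \<omega>) = T n (\<lambda>k. f k \<omega>)" for n
      using tail_average_diff[OF T[of n], of "\<lambda>k. Z k \<omega>" "\<lambda>k. Ys k \<omega>"] by (simp add: Ys_eq)
    ultimately show ?case by simp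
  qed
  have bounds: "AE \<omega> in M. \<forall>n. 0 \<le> T n (\<lambda>k. f k \<omega>) \<and> T n (\<lambda>k. f k \<omega>) \<le> 1"
    using Tf unfolding AE_all_countable by (auto simp: small_functions_def)
  have "(\<lambda>\<omega>. Z' \<omega> - Y \<omega>) \<in> small_functions M e"
    unfolding small_functions_def
  proof (intro CollectI conjI)
    show meas: "(\<lambda>\<omega>. Z' \<omega> - Y \<omega>) \<in> borel_measurable M" using Z'm Y by measurable
    show "AE \<omega> in M. 0 \<le> Z' \<omega> - Y \<omega> \<and> Z' \<omega> - Y \<omega> \<le> 1"
      using limf bounds
    proof eventually_elim
      case (elim \<omega>)
      then show ?case using LIMSEQ_le_const[OF elim(1), of 0] LIMSEQ_le_const2[OF elim(1), of 1] by blast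
    qed
    have "(\<lambda>n. expectation (\<lambda>\<omega>. T n (\<lambda>k. f k \<omega>))) \<longlonglongrightarrow> expectation (\<lambda>\<omega>. Z' \<omega> - Y \<omega>)"
    proof (rule integral_dominated_convergence[where w="\<lambda>_. 1"])
      show "(\<lambda>\<omega>. T n (\<lambda>k. f k \<omega>)) \<in> borel_measurable M" for n using Tf by (simp add: small_functions_def)
      show "AE \<omega> in M. norm (T n (\<lambda>k. f k \<omega>)) \<le> 1" for n
        using bounds by eventually_elim simp
    qed (use meas limf in auto)
    then show "expectation (\<lambda>\<omega>. Z' \<omega> - Y \<omega>) \<le> e"
      using Tf by (intro LIMSEQ_le_const2) (auto simp: small_functions_def)
  qed
  from lower_by_smallI[OF Z' this] show "Y \<in> lower_by_small M e S" by simp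
qed

lemma (in prob_space) bounded_closed_convex_lower_by_small:
  assumes S: "bounded_closed_convex M S"
  shows "bounded_closed_convex M (lower_by_small M e S)"
  unfolding bounded_closed_convex_def
proof (intro conjI)
  have Sm: "S \<subseteq> borel_measurable M" "convex_functions S" "closed_under_ae_convergence M S"
    using S by (auto simp: bounded_closed_convex_def)
  obtain c where c: "\<And>X. X \<in> S \<Longrightarrow> AE \<omega> in M. \<bar>X \<omega>\<bar> \<le> c"
    using S by (auto simp: bounded_closed_convex_def)
  show "lower_by_small M e S \<subseteq> borel_measurable M"
    using Sm(1) by (auto simp: lower_by_small_def small_functions_def)
  show "convex_functions (lower_by_small M e S)"
    unfolding convex_functions_def
  proof (intro ballI)
    fix X Y and l :: real
    assume "X \<in> lower_by_small M e S" "Y \<in> lower_by_small M e S" and l: "l \<in> {0..1}"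
    then obtain Z f W g where *: "Z \<in> S" "f \<in> small_functions M e" "W \<in> S" "g \<in> small_functions M e"
      "X = (\<lambda>\<omega>. Z \<omega> - f \<omega>)" "Y = (\<lambda>\<omega>. W \<omega> - g \<omega>)"
      by (auto simp: lower_by_small_def)
    have "(\<lambda>\<omega>. l * Z \<omega> + (1 - l) * W \<omega>) \<in> S"
      using Sm(2) *(1,3) l unfolding convex_functions_def by blast
    moreover have "(\<lambda>\<omega>. l * f \<omega> + (1 - l) * g \<omega>) \<in> small_functions M e"
      using small_functions_convex[of e] *(2,4) l unfolding convex_functions_def by blast
    moreover have "(\<lambda>\<omega>. l * X \<omega> + (1 - l) * Y \<omega>) =
        (\<lambda>\<omega>. (l * Z \<omega> + (1 - l) * W \<omega>) - (l * f \<omega> + (1 - l) * g \<omega>))"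
      unfolding *(5,6) by (intro ext) (simp add: algebra_simps)
    ultimately show "(\<lambda>\<omega>. l * X \<omega> + (1 - l) * Y \<omega>) \<in> lower_by_small M e S"
      using lower_by_smallI[of "\<lambda>\<omega>. l * Z \<omega> + (1 - l) * W \<omega>" S
          "\<lambda>\<omega>. l * f \<omega> + (1 - l) * g \<omega>" M e] by simp
  qed
  show "\<exists>c. \<forall>X\<in>lower_by_small M e S. AE \<omega> in M. \<bar>X \<omega>\<bar> \<le> c"
  proof (intro exI ballI)
    fix X assume "X \<in> lower_by_small M e S"
    then obtain Z f where *: "Z \<in> S" "f \<in> small_functions M e" "X = (\<lambda>\<omega>. Z \<omega> - f \<omega>)"
      by (auto simp: lower_by_small_def)
    then have "AE \<omega> in M. 0 \<le> f \<omega> \<and> f \<omega> \<le> 1" by (auto simp: small_functions_def)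
    then show "AE \<omega> in M. \<bar>X \<omega>\<bar> \<le> c + 1"
      using c[OF *(1)] by eventually_elim (auto simp: *(3))
  qed
qed (rule lower_by_small_closed[OF S])

lemma AE_tendsto_zero_of_summable_integrals:
  fixes f :: "nat \<Rightarrow> 'a \<Rightarrow> real"
  assumes int: "\<And>n. integrable M (f n)" and nonneg: "\<And>n. AE \<omega> in M. 0 \<le> f n \<omega>"
    and le: "\<And>n. (LINT \<omega>|M. f n \<omega>) \<le> (1/2)^n"
  shows "AE \<omega> in M. (\<lambda>n. f n \<omega>) \<longlonglongrightarrow> 0"
proof -
  have [measurable]: "f n \<in> borel_measurable M" for n using int by auto
  have "(\<integral>\<^sup>+\<omega>. (\<Sum>n. ennreal (f n \<omega>)) \<partial>M) = (\<Sum>n. \<integral>\<^sup>+\<omega>. ennreal (f n \<omega>) \<partial>M)"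
    by (intro nn_integral_suminf) auto
  also have "\<dots> \<le> (\<Sum>n. ennreal ((1/2)^n))"
    using le nonneg int by (intro suminf_le) (auto simp: nn_integral_eq_integral intro!: ennreal_leI)
  also have "\<dots> = ennreal (\<Sum>n. (1/2)^n)"
    by (intro suminf_ennreal2) (auto simp: summable_geometric)
  also have "\<dots> < \<infinity>" by simp
  finally have "AE \<omega> in M. (\<Sum>n. ennreal (f n \<omega>)) \<noteq> \<infinity>" by (intro nn_integral_PInf_AE) auto
  moreover have "AE \<omega> in M. \<forall>n. 0 \<le> f n \<omega>" using nonneg by (simp add: AE_all_countable)
  ultimately show ?thesis
  proof eventually_elim
    case (elim \<omega>)
    then have "summable (\<lambda>n. f n \<omega>)" by (intro summable_suminf_not_top) auto
    then show ?case by (rule summable_LIMSEQ_zero)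
  qed
qed

section \<open>Lower semicontinuous convex expectations\<close>

text \<open>
Continuity from below is equivalent to lower semicontinuity along bounded a.e. convergent
sequences; the locale is named after the property that the proofs use, \<open>rho_fatou\<close>.
\<close>

locale lsc_convex_expectation = prob_space M for M :: "'a measure" +
  fixes \<rho> :: "('a \<Rightarrow> real) \<Rightarrow> real"
  assumes convex_exp: "convex_expectation M \<rho>" and cont_below: "continuous_from_below M \<rho>"
begin

lemma rho_mono: "X \<in> Linf M \<Longrightarrow> Y \<in> Linf M \<Longrightarrow> AE \<omega> in M. X \<omega> \<le> Y \<omega> \<Longrightarrow> \<rho> X \<le> \<rho> Y"
  using convex_exp by (auto simp: convex_expectation_def)

lemma rho_shift: "X \<in> Linf M \<Longrightarrow> \<rho> (\<lambda>\<omega>. X \<omega> + c) = \<rho> X + c"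
  using convex_exp by (auto simp: convex_expectation_def)

lemma rho_const: "\<rho> (\<lambda>_. c) = \<rho> (\<lambda>_. 0) + c"
  using rho_shift[OF Linf_const, of 0 c] by simp

lemma rho_convex:
  "X \<in> Linf M \<Longrightarrow> Y \<in> Linf M \<Longrightarrow> 0 \<le> l \<Longrightarrow> l \<le> 1 \<Longrightarrow>
    \<rho> (\<lambda>\<omega>. l * X \<omega> + (1 - l) * Y \<omega>) \<le> l * \<rho> X + (1 - l) * \<rho> Y"
  using convex_exp by (auto simp: convex_expectation_def)

lemma rho_tail_average:
  assumes "tail_average n T" and X: "\<And>k. X k \<in> Linf M"
  shows "\<rho> (\<lambda>\<omega>. T (\<lambda>k. X k \<omega>)) \<le> T (\<lambda>k. \<rho> (X k))"
  using assms(1)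
proof (induction rule: tail_average.induct)
  case (mix T U l)
  have "(\<lambda>\<omega>. T (\<lambda>k. X k \<omega>)) \<in> Linf M" "(\<lambda>\<omega>. U (\<lambda>k. X k \<omega>)) \<in> Linf M"
    by (intro tail_average_mem[OF mix.hyps(1) Linf_convex X] tail_average_mem[OF mix.hyps(2) Linf_convex X])+
  from rho_convex[OF this mix.hyps(3,4)] show ?case
    using mult_left_mono[OF mix.IH(1) mix.hyps(3)] mult_left_mono[OF mix.IH(2), of "1 - l"] mix.hyps(4)
    by simp
qed simp

text \<open>
The infima \<open>inf\<^sub>k\<^sub>\<ge>\<^sub>n Xs k\<close> increase to the limit and lie below \<open>Xs n\<close>. Truncation at \<open>c\<close> makes
them real-valued everywhere and changes nothing a.e.
\<close>

lemma rho_fatou: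
  assumes Xs: "\<And>n. Xs n \<in> borel_measurable M" and bound: "\<And>n. AE \<omega> in M. \<bar>Xs n \<omega>\<bar> \<le> c"
    and X: "X \<in> borel_measurable M" and lim: "AE \<omega> in M. (\<lambda>n. Xs n \<omega>) \<longlonglongrightarrow> X \<omega>"
    and le: "\<And>n. \<rho> (Xs n) \<le> d"
  shows "\<rho> X \<le> d"
proof -
  define W where "W n \<omega> = max (- \<bar>c\<bar>) (min \<bar>c\<bar> (Xs n \<omega>))" for n \<omega>
  define Y where "Y n \<omega> = (INF k\<in>{n..}. W k \<omega>)" for n \<omega>
  have W_bounds: "- \<bar>c\<bar> \<le> W n \<omega>" "W n \<omega> \<le> \<bar>c\<bar>" for n \<omega> by (auto simp: W_def)
  have bdd: "bdd_below ((\<lambda>k. W k \<omega>) ` {n..})" for n \<omega>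
    using W_bounds by (intro bdd_belowI2)
  have W_meas: "W n \<in> borel_measurable M" for n unfolding W_def using Xs by measurable
  have Y_le: "Y n \<omega> \<le> W k \<omega>" if "n \<le> k" for n k \<omega>
    unfolding Y_def using that bdd by (intro cINF_lower) auto
  have Y_ge: "a \<le> Y n \<omega>" if "\<And>k. n \<le> k \<Longrightarrow> a \<le> W k \<omega>" for a n \<omega>
    unfolding Y_def using that by (intro cINF_greatest) auto
  have Y_meas: "Y n \<in> borel_measurable M" for n
    unfolding Y_def using W_meas bdd by (intro borel_measurable_cINF) auto
  have all: "AE \<omega> in M. \<forall>n. \<bar>Xs n \<omega>\<bar> \<le> c" using bound by (simp add: AE_all_countable)
  have Y_Linf: "Y n \<in> Linf M" for n
  proof -
    have "\<bar>Y n \<omega>\<bar> \<le> \<bar>c\<bar>" for \<omega>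
      using Y_le[of n n \<omega>] W_bounds(2)[of n \<omega>] Y_ge[of n "- \<bar>c\<bar>" \<omega>, OF W_bounds(1)]
      by (simp add: abs_le_iff)
    then show ?thesis using Y_meas by (auto simp: Linf_def)
  qed
  have "AE \<omega> in M. \<bar>X \<omega>\<bar> \<le> c"
    using lim all
  proof eventually_elim
    case (elim \<omega>)
    then show ?case using LIMSEQ_le_const2[OF tendsto_rabs[OF elim(1)], of c] by blast
  qed
  then have X_Linf: "X \<in> Linf M" using X by (auto simp: Linf_def)
  have "AE \<omega> in M. incseq (\<lambda>n. Y n \<omega>) \<and> (\<lambda>n. Y n \<omega>) \<longlonglongrightarrow> X \<omega>"
    using lim all
  proof eventually_elim
    case (elim \<omega>)
    have W_eq: "W n \<omega> = Xs n \<omega>" for n using elim(2) by (auto simp: W_def abs_le_iff dest: spec[of _ n])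
    have inc: "incseq (\<lambda>n. Y n \<omega>)"
      by (intro monoI Y_ge Y_le) auto
    have "(\<lambda>n. Y n \<omega>) \<longlonglongrightarrow> X \<omega>"
    proof (rule LIMSEQ_I)
      fix e :: real assume "0 < e"
      then obtain N where N: "\<And>k. k \<ge> N \<Longrightarrow> \<bar>Xs k \<omega> - X \<omega>\<bar> < e/2"
        using LIMSEQ_D[OF elim(1), of "e/2"] by auto
      have "\<bar>Y n \<omega> - X \<omega>\<bar> < e" if "n \<ge> N" for n
      proof -
        have "X \<omega> - e/2 \<le> Y n \<omega>"
        proof (rule Y_ge)
          fix k assume "n \<le> k"
          then have "\<bar>Xs k \<omega> - X \<omega>\<bar> < e/2" using N that by simp
          then show "X \<omega> - e/2 \<le> W k \<omega>" unfolding W_eq by linarith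
        qed
        moreover have "Y n \<omega> \<le> X \<omega> + e/2" using Y_le[of n n \<omega>] N[OF that] unfolding W_eq by linarith
        ultimately show ?thesis using \<open>0 < e\<close> by (simp add: abs_less_iff)
      qed
      then show "\<exists>N. \<forall>n\<ge>N. norm (Y n \<omega> - X \<omega>) < e" by auto
    qed
    with inc show ?case by simp
  qed
  then have "(\<lambda>n. \<rho> (Y n)) \<longlonglongrightarrow> \<rho> X"
    using cont_below Y_Linf X_Linf unfolding continuous_from_below_def by blast
  moreover have "\<rho> (Y n) \<le> d" for n
  proof -
    have "AE \<omega> in M. Y n \<omega> \<le> Xs n \<omega>"
      using bound[of n]
    proof eventually_elim
      case (elim \<omega>)
      then show ?case using Y_le[of n n \<omega>] by (auto simp: W_def)
    qed
    moreover have "Xs n \<in> Linf M" using Xs bound by (auto simp: Linf_def)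
    ultimately show ?thesis using rho_mono[OF Y_Linf] le[of n] by force
  qed
  ultimately show ?thesis by (intro LIMSEQ_le_const2) auto
qed

text \<open>
Otherwise there are \<open>Z\<^sub>n \<in> S\<close> and \<open>f\<^sub>n\<close> of integral at most \<open>2\<^sup>-\<^sup>n\<close> with
\<open>\<rho> (Z\<^sub>n - f\<^sub>n) \<le> d\<close>. Then \<open>f\<^sub>n\<close> tends to zero a.e., so averages of \<open>Z\<^sub>n - f\<^sub>n\<close> converge to an
element of \<open>S\<close>, at which \<open>\<rho>\<close> is at most \<open>d\<close> by convexity and lower semicontinuity.
\<close>

lemma rho_gap_stable:
  assumes S: "bounded_closed_convex M S" and gap: "\<And>Z. Z \<in> S \<Longrightarrow> d < \<rho> Z"
  shows "\<exists>e>0. \<forall>Z\<in>lower_by_small M e S. d < \<rho> Z"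
proof (rule ccontr)
  assume neg: "\<not> ?thesis"
  have "\<exists>Z f. Z \<in> S \<and> f \<in> small_functions M ((1/2)^n) \<and> \<rho> (\<lambda>\<omega>. Z \<omega> - f \<omega>) \<le> d" for n :: nat
  proof -
    have "0 < (1/2::real)^n" by simp
    with neg obtain X where "X \<in> lower_by_small M ((1/2)^n) S" "\<not> d < \<rho> X" by blast
    then show ?thesis by (auto simp: lower_by_small_def not_less)
  qed
  then have "\<exists>p. \<forall>n::nat. fst (p n) \<in> S \<and> snd (p n) \<in> small_functions M ((1/2)^n) \<and>
      \<rho> (\<lambda>\<omega>. fst (p n) \<omega> - snd (p n) \<omega>) \<le> d"
    by (intro choice allI) auto
  then obtain p where p: "\<And>n::nat. fst (p n) \<in> S \<and> snd (p n) \<in> small_functions M ((1/2)^n) \<and>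
      \<rho> (\<lambda>\<omega>. fst (p n) \<omega> - snd (p n) \<omega>) \<le> d" by blast
  define Z f where "Z n = fst (p n)" and "f n = snd (p n)" for n
  have Z: "\<And>n. Z n \<in> S" and f: "\<And>n. f n \<in> small_functions M ((1/2)^n)"
    and low: "\<And>n. \<rho> (\<lambda>\<omega>. Z n \<omega> - f n \<omega>) \<le> d" using p by (auto simp: Z_def f_def)
  obtain c where c: "\<And>X. X \<in> S \<Longrightarrow> AE \<omega> in M. \<bar>X \<omega>\<bar> \<le> c"
    using S by (auto simp: bounded_closed_convex_def)
  obtain T Z' where T: "\<And>n. tail_average n (T n)" and Z': "Z' \<in> S"
    and limZ: "AE \<omega> in M. (\<lambda>n. T n (\<lambda>k. Z k \<omega>)) \<longlonglongrightarrow> Z' \<omega>"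
    using bounded_closed_convex_komlos[OF S, of Z] Z by auto
  have fb: "AE \<omega> in M. 0 \<le> f n \<omega> \<and> f n \<omega> \<le> 1" for n using f by (auto simp: small_functions_def)
  have limf: "AE \<omega> in M. (\<lambda>n. f n \<omega>) \<longlonglongrightarrow> 0"
  proof (rule AE_tendsto_zero_of_summable_integrals)
    show "integrable M (f n)" for n using small_functions_integrable[OF f] .
    show "AE \<omega> in M. 0 \<le> f n \<omega>" for n using fb[of n] by (auto elim!: eventually_mono)
    show "expectation (f n) \<le> (1/2)^n" for n using f[of n] by (simp add: small_functions_def)
  qed
  define Y where "Y n \<omega> = Z n \<omega> - f n \<omega>" for n \<omega>
  have Y_meas: "Y n \<in> borel_measurable M" for n
    using Z[of n] f[of n] S unfolding Y_def bounded_closed_convex_def small_functions_def by auto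
  have Y_bound: "AE \<omega> in M. \<bar>Y n \<omega>\<bar> \<le> c + 1" for n
    using c[OF Z, of n] fb[of n] by eventually_elim (auto simp: Y_def)
  have Y_Linf: "Y n \<in> Linf M" for n using Y_meas Y_bound by (auto simp: Linf_def)
  have "\<rho> Z' \<le> d"
  proof (rule rho_fatou[where Xs="\<lambda>n \<omega>. T n (\<lambda>k. Y k \<omega>)"])
    show "(\<lambda>\<omega>. T n (\<lambda>k. Y k \<omega>)) \<in> borel_measurable M" for n
      by (intro tail_average_measurable[OF T] Y_meas)
    have "AE \<omega> in M. \<forall>k. \<bar>Y k \<omega>\<bar> \<le> c + 1" using Y_bound by (simp add: AE_all_countable)
    then show "AE \<omega> in M. \<bar>T n (\<lambda>k. Y k \<omega>)\<bar> \<le> c + 1" for n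
    proof eventually_elim
      case (elim \<omega>)
      have "- (c + 1) \<le> Y k \<omega>" "Y k \<omega> \<le> c + 1" for k using elim[rule_format, of k] by linarith+
      then have "T n (\<lambda>k. Y k \<omega>) \<le> c + 1" "- (c + 1) \<le> T n (\<lambda>k. Y k \<omega>)"
        by (auto intro: tail_average_le[OF T[of n]] tail_average_ge[OF T[of n]])
      then show ?case by linarith
    qed
    show "Z' \<in> borel_measurable M" using Z' S by (auto simp: bounded_closed_convex_def)
    show "AE \<omega> in M. (\<lambda>n. T n (\<lambda>k. Y k \<omega>)) \<longlonglongrightarrow> Z' \<omega>"
      using limZ limf
    proof eventually_elim
      case (elim \<omega>)
      have "(\<lambda>n. T n (\<lambda>k. Z k \<omega>) - T n (\<lambda>k. f k \<omega>)) \<longlonglongrightarrow> Z' \<omega> - 0"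
        by (intro tendsto_diff elim(1) tail_average_tendsto[OF T elim(2)])
      then show ?case by (simp add: Y_def tail_average_diff[OF T])
    qed
    show "\<rho> (\<lambda>\<omega>. T n (\<lambda>k. Y k \<omega>)) \<le> d" for n
    proof -
      have "\<rho> (Y k) \<le> d" for k using low[of k] by (simp add: Y_def[abs_def])
      then have "T n (\<lambda>k. \<rho> (Y k)) \<le> d" by (intro tail_average_le[OF T])
      then show ?thesis using rho_tail_average[OF T[of n], of Y] Y_Linf by force
    qed
  qed
  with gap[OF Z'] show False by simp
qed

text \<open>
Iterating \<open>rho_gap_stable\<close> subtracts one more small function at each step, with a size that
depends on the previous steps only. This resembles the construction in the proof of the
Krein-Smulian theorem. The indicator of a set of measure below the first \<open>j\<close> sizes may be subtracted
\<open>j\<close> times.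
\<close>

lemma absorbing_enlargement:
  assumes S: "bounded_closed_convex M S" and gap: "\<And>Z. Z \<in> S \<Longrightarrow> d < \<rho> Z"
  obtains C where "S \<subseteq> C" "C \<subseteq> Linf M" "convex_functions C" "\<And>Z. Z \<in> C \<Longrightarrow> d < \<rho> Z"
    "\<And>j::nat. \<exists>\<eta>>0. \<forall>A\<in>sets M. prob A \<le> \<eta> \<longrightarrow>
       (\<forall>Z\<in>S. (\<lambda>\<omega>. Z \<omega> - real j * indicator A \<omega>) \<in> C)"
proof -
  have "\<exists>R. \<forall>n. ((n = 0 \<longrightarrow> R n = S) \<and> bounded_closed_convex M (R n) \<and> (\<forall>Z\<in>R n. d < \<rho> Z))
      \<and> (\<exists>e>0. R (Suc n) = lower_by_small M e (R n))"
  proof (rule dependent_nat_choice[where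
        P="\<lambda>n x. (n = 0 \<longrightarrow> x = S) \<and> bounded_closed_convex M x \<and> (\<forall>Z\<in>x. d < \<rho> Z)" and
        Q="\<lambda>n x y. \<exists>e>0. y = lower_by_small M e x"])
    show "\<exists>x. ((0::nat) = 0 \<longrightarrow> x = S) \<and> bounded_closed_convex M x \<and> (\<forall>Z\<in>x. d < \<rho> Z)"
      using S gap by blast
    fix x and n :: nat
    assume "(n = 0 \<longrightarrow> x = S) \<and> bounded_closed_convex M x \<and> (\<forall>Z\<in>x. d < \<rho> Z)"
    then have x: "bounded_closed_convex M x" "\<And>Z. Z \<in> x \<Longrightarrow> d < \<rho> Z" by auto
    from rho_gap_stable[OF this] obtain e where "e > 0" "\<forall>Z\<in>lower_by_small M e x. d < \<rho> Z" by blast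
    with bounded_closed_convex_lower_by_small[OF x(1)]
    show "\<exists>y. ((Suc n = 0 \<longrightarrow> y = S) \<and> bounded_closed_convex M y \<and> (\<forall>Z\<in>y. d < \<rho> Z)) \<and>
        (\<exists>e>0. y = lower_by_small M e x)" by blast
  qed
  then obtain R where R_all: "\<forall>n. ((n = 0 \<longrightarrow> R n = S) \<and> bounded_closed_convex M (R n) \<and> (\<forall>Z\<in>R n. d < \<rho> Z))
      \<and> (\<exists>e>0. R (Suc n) = lower_by_small M e (R n))" ..
  then have R0: "R 0 = S" and R: "\<And>n. bounded_closed_convex M (R n)"
    and Rgap: "\<And>n Z. Z \<in> R n \<Longrightarrow> d < \<rho> Z"
    and Rstep: "\<And>n. \<exists>e>0. R (Suc n) = lower_by_small M e (R n)" by simp_all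
  have "R n \<subseteq> R (Suc n)" for n
  proof -
    obtain e where "e > 0" "R (Suc n) = lower_by_small M e (R n)" using Rstep by blast
    then show ?thesis using lower_by_small_superset[of e "R n" M] by simp
  qed
  then have Rmono: "i \<le> j \<Longrightarrow> R i \<subseteq> R j" for i j by (rule lift_Suc_mono_le)
  define C where "C = (\<Union>n. R n)"
  have abs: "\<exists>\<eta>>0. \<forall>A\<in>sets M. prob A \<le> \<eta> \<longrightarrow>
      (\<forall>Z\<in>S. (\<lambda>\<omega>. Z \<omega> - real j * indicator A \<omega>) \<in> R j)" for j
  proof (induction j)
    case 0
    show ?case using R0 by (intro exI[of _ 1]) auto
  next
    case (Suc j)
    then obtain \<eta> where \<eta>: "\<eta> > 0" "\<And>A Z. A \<in> sets M \<Longrightarrow> prob A \<le> \<eta> \<Longrightarrow> Z \<in> S \<Longrightarrow>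
      (\<lambda>\<omega>. Z \<omega> - real j * indicator A \<omega>) \<in> R j" by blast
    obtain e where e: "e > 0" "R (Suc j) = lower_by_small M e (R j)" using Rstep by blast
    show ?case
    proof (intro exI[of _ "min \<eta> e"] conjI ballI impI)
      show "0 < min \<eta> e" using \<eta> e by simp
      fix A Z assume A: "A \<in> sets M" "prob A \<le> min \<eta> e" and Z: "Z \<in> S"
      have "indicator A \<in> small_functions M e"
        using A by (auto simp: small_functions_def indicator_def)
      moreover have "(\<lambda>\<omega>. Z \<omega> - real j * indicator A \<omega>) \<in> R j" using \<eta>(2) A Z by auto
      moreover have "(\<lambda>\<omega>. Z \<omega> - real (Suc j) * indicator A \<omega>) =
          (\<lambda>\<omega>. (Z \<omega> - real j * indicator A \<omega>) - indicator A \<omega>)"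
        by (intro ext) (simp add: algebra_simps)
      ultimately show "(\<lambda>\<omega>. Z \<omega> - real (Suc j) * indicator A \<omega>) \<in> R (Suc j)"
        unfolding e(2) using lower_by_smallI by simp
    qed
  qed
  show thesis
  proof (rule that[of C])
    show "S \<subseteq> C" using R0 by (auto simp: C_def)
    show "C \<subseteq> Linf M" using bounded_closed_convex_subset_Linf[OF R] by (auto simp: C_def)
    show "convex_functions C"
      unfolding convex_functions_def
    proof (intro ballI)
      fix X Y and l :: real assume "X \<in> C" "Y \<in> C" and l: "l \<in> {0..1}"
      then obtain i j where "X \<in> R i" "Y \<in> R j" by (auto simp: C_def)
      then have "X \<in> R (max i j)" "Y \<in> R (max i j)"
        using Rmono[of i "max i j"] Rmono[of j "max i j"] by auto
      then have "(\<lambda>\<omega>. l * X \<omega> + (1 - l) * Y \<omega>) \<in> R (max i j)"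
        using R[of "max i j"] l by (auto simp: bounded_closed_convex_def convex_functions_def)
      then show "(\<lambda>\<omega>. l * X \<omega> + (1 - l) * Y \<omega>) \<in> C" by (auto simp: C_def)
    qed
    show "d < \<rho> Z" if "Z \<in> C" for Z using that Rgap by (auto simp: C_def)
    show "\<exists>\<eta>>0. \<forall>A\<in>sets M. prob A \<le> \<eta> \<longrightarrow>
       (\<forall>Z\<in>S. (\<lambda>\<omega>. Z \<omega> - real j * indicator A \<omega>) \<in> C)" for j
      using abs[of j] unfolding C_def by blast
  qed
qed

end

section \<open>Supporting functionals and countable additivity\<close>

definition linear_on :: "('a \<Rightarrow> real) set \<Rightarrow> (('a \<Rightarrow> real) \<Rightarrow> real) \<Rightarrow> bool" where
  "linear_on V l \<longleftrightarrow>
     (\<forall>X\<in>V. \<forall>Y\<in>V. \<forall>a b. l (\<lambda>\<omega>. a * X \<omega> + b * Y \<omega>) = a * l X + b * l Y)"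

lemma linear_onD:
  assumes "linear_on V l" "X \<in> V" "Y \<in> V"
  shows "l (\<lambda>\<omega>. a * X \<omega> + b * Y \<omega>) = a * l X + b * l Y" "l (\<lambda>\<omega>. X \<omega> + Y \<omega>) = l X + l Y"
    "l (\<lambda>\<omega>. X \<omega> - Y \<omega>) = l X - l Y" "l (\<lambda>\<omega>. a * X \<omega>) = a * l X"
    "l (\<lambda>\<omega>. X \<omega> + b * Y \<omega>) = l X + b * l Y" "l (\<lambda>\<omega>. X \<omega> - b * Y \<omega>) = l X - b * l Y"
    "l (\<lambda>_. 0) = 0"
proof -
  have *: "l (\<lambda>\<omega>. a * X \<omega> + b * Y \<omega>) = a * l X + b * l Y" for a b
    using assms by (auto simp: linear_on_def)
  show "l (\<lambda>\<omega>. a * X \<omega> + b * Y \<omega>) = a * l X + b * l Y" "l (\<lambda>\<omega>. X \<omega> + Y \<omega>) = l X + l Y"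
    "l (\<lambda>\<omega>. X \<omega> - Y \<omega>) = l X - l Y" "l (\<lambda>\<omega>. a * X \<omega>) = a * l X"
    "l (\<lambda>\<omega>. X \<omega> + b * Y \<omega>) = l X + b * l Y" "l (\<lambda>\<omega>. X \<omega> - b * Y \<omega>) = l X - b * l Y"
    "l (\<lambda>_. 0) = 0"
    using *[of a b] *[of 1 1] *[of 1 "-1"] *[of a 0] *[of 1 b] *[of 1 "-b"] *[of 0 0] by auto
qed

context lsc_convex_expectation begin

lemma rho_lipschitz:
  assumes X: "X \<in> Linf M" and Y: "Y \<in> Linf M" and "AE \<omega> in M. \<bar>Y \<omega>\<bar> \<le> c"
  shows "\<rho> X - c \<le> \<rho> (\<lambda>\<omega>. Y \<omega> + X \<omega>)"
proof -
  have "\<rho> (\<lambda>\<omega>. X \<omega> + (- c)) \<le> \<rho> (\<lambda>\<omega>. Y \<omega> + X \<omega>)"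
  proof (rule rho_mono)
    show "(\<lambda>\<omega>. X \<omega> + - c) \<in> Linf M" by (rule Linf_closed(2)[OF X Linf_const])
    show "(\<lambda>\<omega>. Y \<omega> + X \<omega>) \<in> Linf M" by (rule Linf_closed(2)[OF Y X])
    show "AE \<omega> in M. X \<omega> + - c \<le> Y \<omega> + X \<omega>" using assms(3) by eventually_elim auto
  qed
  then show ?thesis using rho_shift[OF X, of "- c"] by simp
qed

text \<open>
The functional \<open>Y \<mapsto> inf (\<rho> (t Y + Z) - m) / t\<close>, with the infimum over \<open>t > 0\<close> and \<open>Z \<in> C\<close>, is
the sublinear hull of the convex function \<open>Y \<mapsto> inf\<^sub>Z \<rho> (Y + Z) - m\<close>, which is nonnegative at zero.
It is finite because \<open>\<rho>\<close> is bounded below on \<open>C\<close>. A linear functional below it, evaluated at \<open>W - Z\<close> with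
\<open>t = 1\<close>, supports \<open>\<rho>\<close> over \<open>C\<close>.
\<close>

lemma supporting_functional:
  assumes C: "C \<subseteq> Linf M" "convex_functions C" "C \<noteq> {}" and m: "\<And>Z. Z \<in> C \<Longrightarrow> m \<le> \<rho> Z"
  obtains l where "linear_on (Linf M) l" "\<And>W Z. W \<in> Linf M \<Longrightarrow> Z \<in> C \<Longrightarrow> l W - \<rho> W \<le> l Z - m"
proof -
  define I where "I = {0::real<..} \<times> C"
  define Q where "Q Y p = (\<rho> (\<lambda>\<omega>. fst p * Y \<omega> + snd p \<omega>) - m) / fst p" for Y and p :: "real \<times> ('a \<Rightarrow> real)"
  define q where "q Y = (INF p\<in>I. Q Y p)" for Y
  have I_ne: "I \<noteq> {}" using C(3) by (auto simp: I_def)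
  have bdd: "bdd_below (Q Y ` I)" if Y: "Y \<in> Linf M" for Y
  proof -
    obtain c where c: "AE \<omega> in M. \<bar>Y \<omega>\<bar> \<le> c" using Y by (auto simp: Linf_def)
    have "- c \<le> Q Y p" if "p \<in> I" for p
    proof -
      have p: "0 < fst p" "snd p \<in> C" using that by (auto simp: I_def)
      have "AE \<omega> in M. \<bar>fst p * Y \<omega>\<bar> \<le> fst p * c"
        using c by eventually_elim (use p in \<open>auto simp: abs_mult\<close>)
      from rho_lipschitz[OF _ Linf_closed(5)[OF Y Y] this, of "snd p"]
      have "\<rho> (snd p) - fst p * c \<le> \<rho> (\<lambda>\<omega>. fst p * Y \<omega> + snd p \<omega>)" using p C by auto
      then show ?thesis using m[OF p(2)] p(1) by (simp add: Q_def field_simps)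
    qed
    then show ?thesis by (intro bdd_belowI2)
  qed
  have q_le: "q Y \<le> (\<rho> (\<lambda>\<omega>. t * Y \<omega> + Z \<omega>) - m) / t" if "Y \<in> Linf M" "0 < t" "Z \<in> C" for Y t Z
    using cINF_lower[OF bdd[OF that(1)], of "(t, Z)"] that by (simp add: q_def Q_def I_def)
  have q_ge: "b \<le> q Y" if "\<And>t Z. 0 < t \<Longrightarrow> Z \<in> C \<Longrightarrow> b \<le> (\<rho> (\<lambda>\<omega>. t * Y \<omega> + Z \<omega>) - m) / t" for b Y
    unfolding q_def using that by (intro cINF_greatest[OF I_ne]) (auto simp: Q_def I_def)
  have "sublinear_on (Linf M) q"
    unfolding sublinear_on_def
  proof (intro conjI ballI allI impI)
    show "q (\<lambda>_. 0) = 0"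
    proof (rule antisym)
      obtain Z where Z: "Z \<in> C" using C(3) by blast
      show "q (\<lambda>_. 0) \<le> 0"
      proof (rule field_le_epsilon)
        fix e :: real assume "0 < e"
        define t where "t = (\<rho> Z - m + 1) / e"
        have t: "0 < t" using m[OF Z] \<open>0 < e\<close> by (simp add: t_def)
        have "(\<rho> Z - m) / t \<le> e" using m[OF Z] \<open>0 < e\<close> by (simp add: t_def field_simps)
        then show "q (\<lambda>_. 0) \<le> 0 + e" using q_le[OF Linf_const t Z, of 0] by simp
      qed
      show "0 \<le> q (\<lambda>_. 0)" using m by (intro q_ge) simp
    qed
  next
    fix X Y assume XY: "X \<in> Linf M" "Y \<in> Linf M"
    have *: "q (\<lambda>\<omega>. X \<omega> + Y \<omega>) \<le>
        (\<rho> (\<lambda>\<omega>. t * X \<omega> + Z \<omega>) - m) / t + (\<rho> (\<lambda>\<omega>. s * Y \<omega> + W \<omega>) - m) / s"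
      if t: "0 < t" "Z \<in> C" and s: "0 < s" "W \<in> C" for t s Z W
    proof -
      \<comment> \<open>The weights and the scale \<open>r\<close> solve \<open>a t = (1 - a) s = r\<close>, so that \<open>a / r = 1 / t\<close> and \<open>(1 - a) / r = 1 / s\<close>.\<close>
      define a where "a = s / (t + s)"
      have a: "0 \<le> a" "a \<le> 1" "1 - a = t / (t + s)" using t s by (auto simp: a_def field_simps)
      define V where "V \<omega> = a * Z \<omega> + (1 - a) * W \<omega>" for \<omega>
      have V: "V \<in> C" using C(2) t(2) s(2) a(1,2) unfolding convex_functions_def V_def[abs_def]
        by (meson atLeastAtMost_iff)
      define r where "r = t * s / (t + s)"
      have r: "0 < r" "a * t = r" "(1 - a) * s = r" using t s a(3) by (auto simp: r_def a_def)
      have L: "(\<lambda>\<omega>. t * X \<omega> + Z \<omega>) \<in> Linf M" "(\<lambda>\<omega>. s * Y \<omega> + W \<omega>) \<in> Linf M"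
        using Linf_closed(1)[OF XY(1), of Z t 1] Linf_closed(1)[OF XY(2), of W s 1] C(1) t s by auto
      have "(\<lambda>\<omega>. r * (X \<omega> + Y \<omega>) + V \<omega>) =
          (\<lambda>\<omega>. a * (t * X \<omega> + Z \<omega>) + (1 - a) * (s * Y \<omega> + W \<omega>))"
      proof (intro ext)
        fix \<omega>
        have "r * (X \<omega> + Y \<omega>) = (a * t) * X \<omega> + ((1 - a) * s) * Y \<omega>"
          by (simp add: r distrib_left)
        then show "r * (X \<omega> + Y \<omega>) + V \<omega> = a * (t * X \<omega> + Z \<omega>) + (1 - a) * (s * Y \<omega> + W \<omega>)"
          by (simp add: V_def algebra_simps)
      qed
      then have "\<rho> (\<lambda>\<omega>. r * (X \<omega> + Y \<omega>) + V \<omega>) - m \<le>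
          a * (\<rho> (\<lambda>\<omega>. t * X \<omega> + Z \<omega>) - m) + (1 - a) * (\<rho> (\<lambda>\<omega>. s * Y \<omega> + W \<omega>) - m)"
        using rho_convex[OF L a(1,2)] by (simp add: algebra_simps)
      then have "(\<rho> (\<lambda>\<omega>. r * (X \<omega> + Y \<omega>) + V \<omega>) - m) / r \<le>
          (a * (\<rho> (\<lambda>\<omega>. t * X \<omega> + Z \<omega>) - m) + (1 - a) * (\<rho> (\<lambda>\<omega>. s * Y \<omega> + W \<omega>) - m)) / r"
        using r(1) by (intro divide_right_mono) auto
      also have "\<dots> = (a / r) * (\<rho> (\<lambda>\<omega>. t * X \<omega> + Z \<omega>) - m) +
          ((1 - a) / r) * (\<rho> (\<lambda>\<omega>. s * Y \<omega> + W \<omega>) - m)"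
        by (simp add: add_divide_distrib)
      also have "a / r = 1 / t" using t s by (simp add: a_def r_def)
      also have "(1 - a) / r = 1 / s" using t s by (simp add: a(3) r_def)
      finally show ?thesis using q_le[OF Linf_closed(2)[OF XY] r(1) V] by simp
    qed
    have "q (\<lambda>\<omega>. X \<omega> + Y \<omega>) - (\<rho> (\<lambda>\<omega>. t * X \<omega> + Z \<omega>) - m) / t \<le> q Y" if "0 < t" "Z \<in> C" for t Z
      using *[OF that] by (intro q_ge) (simp add: diff_le_eq add.commute)
    then have "q (\<lambda>\<omega>. X \<omega> + Y \<omega>) - q Y \<le> q X"
      by (intro q_ge) (simp add: diff_le_eq add.commute)
    then show "q (\<lambda>\<omega>. X \<omega> + Y \<omega>) \<le> q X + q Y" by simp
  next
    fix X and a :: real assume X: "X \<in> Linf M" and a: "0 < a"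
    have "q (\<lambda>\<omega>. a * X \<omega>) / a \<le> q X"
    proof (rule q_ge)
      fix t :: real and Z assume t: "0 < t" "Z \<in> C"
      have "q (\<lambda>\<omega>. a * X \<omega>) \<le> (\<rho> (\<lambda>\<omega>. (t / a) * (a * X \<omega>) + Z \<omega>) - m) / (t / a)"
        using t a by (intro q_le Linf_closed(5)[OF X X]) auto
      also have "(\<lambda>\<omega>. (t / a) * (a * X \<omega>) + Z \<omega>) = (\<lambda>\<omega>. t * X \<omega> + Z \<omega>)" using a by auto
      finally show "q (\<lambda>\<omega>. a * X \<omega>) / a \<le> (\<rho> (\<lambda>\<omega>. t * X \<omega> + Z \<omega>) - m) / t"
        using t a by (simp add: field_simps)
    qed
    then show "q (\<lambda>\<omega>. a * X \<omega>) \<le> a * q X" using a by (simp add: field_simps)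
  qed
  then obtain l where l_le: "\<And>X. X \<in> Linf M \<Longrightarrow> l X \<le> q X"
    and l_lin: "\<And>X Y a b. X \<in> Linf M \<Longrightarrow> Y \<in> Linf M \<Longrightarrow> l (\<lambda>\<omega>. a * X \<omega> + b * Y \<omega>) = a * l X + b * l Y"
    using hahn_banach_dominated[OF Linf_function_space] by blast
  have lin: "linear_on (Linf M) l" unfolding linear_on_def using l_lin by blast
  show thesis
  proof (rule that[OF lin])
    fix W Z assume W: "W \<in> Linf M" and Z: "Z \<in> C"
    then have Z': "Z \<in> Linf M" using C(1) by blast
    have "l (\<lambda>\<omega>. W \<omega> - Z \<omega>) \<le> (\<rho> (\<lambda>\<omega>. 1 * (W \<omega> - Z \<omega>) + Z \<omega>) - m) / 1"
      using l_le[OF Linf_closed(4)[OF W Z']] q_le[OF Linf_closed(4)[OF W Z'] zero_less_one Z] by linarith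
    then show "l W - \<rho> W \<le> l Z - m" by (simp add: linear_onD(3)[OF lin W Z'])
  qed
qed

text \<open>
A functional bounded by \<open>\<rho> + K\<close> inherits monotonicity and translation invariance, because
the constant \<open>K\<close> is negligible after scaling \<open>X\<close>, respectively the constant function, by a large \<open>t\<close>.
\<close>

lemma dominated_functional_positive:
  assumes lin: "linear_on (Linf M) l" and K: "\<And>W. W \<in> Linf M \<Longrightarrow> l W \<le> \<rho> W + K"
    and X: "X \<in> Linf M" "AE \<omega> in M. 0 \<le> X \<omega>"
  shows "0 \<le> l X"
proof (rule ccontr)
  assume neg: "\<not> 0 \<le> l X"
  define t where "t = (\<bar>\<rho> (\<lambda>_. 0) + K\<bar> + 1) / (- l X)"
  have t: "0 < t" unfolding t_def using neg by (intro divide_pos_pos) auto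
  have "\<rho> (\<lambda>\<omega>. (- t) * X \<omega>) \<le> \<rho> (\<lambda>_. 0)"
    using X(2) t by (intro rho_mono Linf_closed(5)[OF X(1) X(1)] Linf_const) (auto elim!: eventually_mono)
  then have "- t * l X \<le> \<rho> (\<lambda>_. 0) + K"
    using K[OF Linf_closed(5)[OF X(1) X(1), of "- t"]] linear_onD(4)[OF lin X(1) X(1), of "- t"] by simp
  moreover have "- t * l X = \<bar>\<rho> (\<lambda>_. 0) + K\<bar> + 1" using neg by (simp add: t_def)
  ultimately show False by simp
qed

lemma dominated_functional_normalized:
  assumes lin: "linear_on (Linf M) l" and K: "\<And>W. W \<in> Linf M \<Longrightarrow> l W \<le> \<rho> W + K"
  shows "l (\<lambda>_. 1) = 1"
proof (rule ccontr)
  assume "l (\<lambda>_. 1) \<noteq> 1"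
  define t where "t = (\<bar>\<rho> (\<lambda>_. 0) + K\<bar> + 1) / (l (\<lambda>_. 1) - 1)"
  have "t * l (\<lambda>_. 1) \<le> \<rho> (\<lambda>_. t) + K"
    using K[OF Linf_const, of t] linear_onD(4)[OF lin Linf_const Linf_const, of t 1] by simp
  then have "t * (l (\<lambda>_. 1) - 1) \<le> \<rho> (\<lambda>_. 0) + K" using rho_const[of t] by (simp add: algebra_simps)
  moreover have "t * (l (\<lambda>_. 1) - 1) = \<bar>\<rho> (\<lambda>_. 0) + K\<bar> + 1"
    using \<open>l (\<lambda>_. 1) \<noteq> 1\<close> by (simp add: t_def)
  ultimately show False by simp
qed

end

text \<open>
The sum equals \<open>\<lfloor>n x\<rfloor> / n\<close>; it expresses a uniform approximation of a function through the
indicators of its superlevel sets.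
\<close>

lemma staircase_approximation:
  fixes x :: real
  assumes x: "0 \<le> x" "x < 1" and n: "0 < n"
  shows "(\<Sum>k\<in>{1..n}. (1 / real n) * (if real k \<le> real n * x then 1 else 0)) \<le> x"
    and "x \<le> (\<Sum>k\<in>{1..n}. (1 / real n) * (if real k \<le> real n * x then 1 else 0)) + 1 / real n"
proof -
  define N where "N = nat \<lfloor>real n * x\<rfloor>"
  have N: "real N \<le> real n * x" "real n * x < real N + 1"
    using x by (auto simp: N_def)
  have "real n * x < real n" using x n by simp
  then have "N \<le> n" using N by linarith
  have "(\<Sum>k\<in>{1..n}. (if real k \<le> real n * x then 1 else 0)) = (\<Sum>k\<in>{1..N}. 1::real)"
  proof (rule sum.mono_neutral_cong_right)
    show "\<forall>i\<in>{1..n} - {1..N}. (if real i \<le> real n * x then 1 else 0) = (0::real)"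
    proof
      fix i assume "i \<in> {1..n} - {1..N}"
      then have "N + 1 \<le> i" by auto
      then have "real N + 1 \<le> real i" by linarith
      then show "(if real i \<le> real n * x then 1 else 0) = (0::real)" using N by auto
    qed
    show "(if real i \<le> real n * x then 1 else 0) = (1::real)" if "i \<in> {1..N}" for i
    proof -
      have "real i \<le> real N" using that by simp
      then show ?thesis using N by auto
    qed
  qed (use \<open>N \<le> n\<close> in auto)
  then have eq: "(\<Sum>k\<in>{1..n}. (1 / real n) * (if real k \<le> real n * x then 1 else 0)) = real N / real n"
    unfolding sum_distrib_left[symmetric] by simp
  show "(\<Sum>k\<in>{1..n}. (1 / real n) * (if real k \<le> real n * x then 1 else 0)) \<le> x"
    and "x \<le> (\<Sum>k\<in>{1..n}. (1 / real n) * (if real k \<le> real n * x then 1 else 0)) + 1 / real n"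
    unfolding eq using N n by (simp_all add: field_simps)
qed

text \<open>
The smallness hypothesis turns the finitely additive set function \<open>A \<mapsto> l 1\<^sub>A\<close> into a measure. The
integral and \<open>l\<close> agree on indicators, hence on staircase functions, and both are monotone, so they
agree on uniform limits of these.
\<close>

lemma (in prob_space) linear_functional_representation:
  assumes lin: "linear_on (Linf M) l"
    and pos: "\<And>X. X \<in> Linf M \<Longrightarrow> AE \<omega> in M. 0 \<le> X \<omega> \<Longrightarrow> 0 \<le> l X"
    and norm: "l (\<lambda>_. 1) = 1"
    and small: "\<And>e. 0 < e \<Longrightarrow> \<exists>\<eta>>0. \<forall>A\<in>sets M. prob A \<le> \<eta> \<longrightarrow> l (indicator A) \<le> e"
  obtains Q where "Q \<in> ac_prob_measures M" "\<And>X. X \<in> Linf M \<Longrightarrow> (LINT \<omega>|Q. X \<omega>) = l X"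
proof -
  note lD = linear_onD[OF lin]
  have mono: "l X \<le> l Y" if "X \<in> Linf M" "Y \<in> Linf M" "AE \<omega> in M. X \<omega> \<le> Y \<omega>" for X Y
    using pos[OF Linf_closed(4)[OF that(2,1)]] that(3) lD(3)[OF that(2,1)] by simp
  have cong: "l X = l Y" if "X \<in> Linf M" "Y \<in> Linf M" "AE \<omega> in M. X \<omega> = Y \<omega>" for X Y
    using that by (intro antisym mono) (auto elim!: eventually_mono)
  have const: "l (\<lambda>_. c) = c" for c using lD(4)[OF Linf_const Linf_const, of c 1] norm by simp
  define \<nu> where "\<nu> A = ennreal (l (indicator A))" for A
  have ind_nonneg: "0 \<le> l (indicator A)" if "A \<in> sets M" for A
    using pos[OF Linf_indicator[OF that]] by simp
  have add: "additive (sets M) \<nu>"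
    unfolding additive_def
  proof (intro ballI impI)
    fix A B assume AB: "A \<in> sets M" "B \<in> sets M" "A \<inter> B = {}"
    have "(indicator (A \<union> B) :: 'a \<Rightarrow> real) = (\<lambda>\<omega>. indicator A \<omega> + indicator B \<omega>)"
      using AB(3) by (auto simp: indicator_def fun_eq_iff)
    then show "\<nu> (A \<union> B) = \<nu> A + \<nu> B"
      using lD(2)[OF Linf_indicator[OF AB(1)] Linf_indicator[OF AB(2)]] ind_nonneg AB by (simp add: \<nu>_def)
  qed
  have "indicator {} = (\<lambda>_::'a. 0::real)" by (auto simp: indicator_def)
  then have posi: "positive (sets M) \<nu>" by (simp add: positive_def \<nu>_def const)
  have "countably_additive (sets M) \<nu>"
  proof (rule sets.empty_continuous_imp_countably_additive[OF posi add])
    show "\<forall>A\<in>sets M. \<nu> A \<noteq> \<infinity>" by (simp add: \<nu>_def)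
    fix A :: "nat \<Rightarrow> 'a set" assume A: "range A \<subseteq> sets M" "decseq A" "(\<Inter>i. A i) = {}"
    have lim: "(\<lambda>i. prob (A i)) \<longlonglongrightarrow> 0" using finite_Lim_measure_decseq[OF A(1,2)] A(3) by simp
    have "(\<lambda>i. l (indicator (A i))) \<longlonglongrightarrow> 0"
    proof (rule LIMSEQ_I)
      fix e :: real assume "0 < e"
      then obtain \<eta> where \<eta>: "\<eta> > 0" "\<And>B. B \<in> sets M \<Longrightarrow> prob B \<le> \<eta> \<Longrightarrow> l (indicator B) \<le> e/2"
        using small[of "e/2"] by auto
      obtain N where N: "\<And>n. n \<ge> N \<Longrightarrow> prob (A n) < \<eta>" using LIMSEQ_D[OF lim \<eta>(1)] by auto
      have "norm (l (indicator (A n)) - 0) < e" if "n \<ge> N" for n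
      proof -
        have An: "A n \<in> sets M" using A(1) by auto
        then have "l (indicator (A n)) \<le> e/2" using \<eta>(2)[of "A n"] N[OF that] by simp
        then show ?thesis using ind_nonneg[OF An] \<open>0 < e\<close> by simp
      qed
      then show "\<exists>N. \<forall>n\<ge>N. norm (l (indicator (A n)) - 0) < e" by blast
    qed
    then show "(\<lambda>i. \<nu> (A i)) \<longlonglongrightarrow> 0"
      unfolding \<nu>_def using tendsto_ennrealI[of "\<lambda>i. l (indicator (A i))" 0] by simp
  qed
  define Q where "Q = measure_of (space M) (sets M) \<nu>"
  have sets_Q [measurable_cong, simp]: "sets Q = sets M" by (simp add: Q_def sets.sets_measure_of_eq)
  have space_Q: "space Q = space M" by (rule sets_eq_imp_space_eq[OF sets_Q])
  have emeas: "emeasure Q A = ennreal (l (indicator A))" if "A \<in> sets M" for A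
    unfolding Q_def using emeasure_measure_of_sigma[OF sets.sigma_algebra_axioms posi _ that]
      \<open>countably_additive (sets M) \<nu>\<close> by (simp add: \<nu>_def)
  have meas: "measure Q A = l (indicator A)" if "A \<in> sets M" for A
    using emeas[OF that] ind_nonneg[OF that] by (simp add: measure_def)
  have "AE \<omega> in M. indicator (space M) \<omega> = (1::real)" by (auto intro!: AE_I2)
  then have "l (indicator (space M)) = 1"
    using cong[OF Linf_indicator[OF sets.top] Linf_const] norm by simp
  then have prob_Q: "prob_space Q" by (intro prob_spaceI) (simp add: space_Q emeas)
  interpret Q: prob_space Q by (rule prob_Q)
  have ac: "absolutely_continuous M Q"
    unfolding absolutely_continuous_def
  proof
    fix A assume A: "A \<in> null_sets M"
    have "AE \<omega> in M. indicator A \<omega> = (0::real)"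
      using AE_not_in[OF A] by eventually_elim simp
    then have "l (indicator A) = 0"
      using cong[OF Linf_indicator Linf_const, of A 0] A const[of 0] by auto
    then show "A \<in> null_sets Q" using A emeas[of A] by (auto simp: null_sets_def)
  qed
  have Q: "Q \<in> ac_prob_measures M" using prob_Q ac by (simp add: ac_prob_measures_def)
  have Linf_Q: "X \<in> Linf Q" if "X \<in> Linf M" for X
    using that absolutely_continuous_AE[OF sets_Q ac]
    unfolding Linf_def measurable_cong_sets[OF sets_Q refl] by blast
  have rep1: "integral\<^sup>L Q X = l X" if X: "X \<in> borel_measurable M" and b: "\<And>\<omega>. 0 \<le> X \<omega>" "\<And>\<omega>. X \<omega> < 1" for X
  proof -
    have XL: "X \<in> Linf M" using X b by (auto simp: Linf_def intro!: exI[of _ 1] less_imp_le)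
    have "\<bar>l X - integral\<^sup>L Q X\<bar> \<le> 1 / real n" if n: "0 < n" for n
    proof -
      define A where "A k = {\<omega>\<in>space M. real k \<le> real n * X \<omega>}" for k :: nat
      have A: "A k \<in> sets M" for k unfolding A_def using X by measurable
      define Y where "Y m \<omega> = (\<Sum>k\<in>{1..m}. (1 / real n) * indicator (A k) \<omega>)" for m :: nat and \<omega>
      have Y: "Y m \<in> Linf M \<and> l (Y m) = integral\<^sup>L Q (Y m)" for m
      proof (induction m)
        case 0
        show ?case using Linf_const[of 0 M] const[of 0] by (simp add: Y_def)
      next
        case (Suc m)
        have "Y (Suc m) = (\<lambda>\<omega>. Y m \<omega> + (1 / real n) * indicator (A (Suc m)) \<omega>)"
          by (auto simp: Y_def)
        moreover have "integrable Q (Y m)" using Q.Linf_integrable[OF Linf_Q] Suc by blast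
        moreover have "integrable Q (indicator (A (Suc m)) :: 'a \<Rightarrow> real)"
          using Q.Linf_integrable[OF Linf_Q[OF Linf_indicator[OF A]]] .
        ultimately show ?case
          using Suc Linf_closed(3)[of "Y m" M "indicator (A (Suc m))" "1 / real n"]
            lD(5)[of "Y m" "indicator (A (Suc m))" "1 / real n"] Linf_indicator[OF A] meas[OF A] A
          by simp
      qed
      have low: "Y n \<omega> \<le> X \<omega>" and up: "X \<omega> \<le> Y n \<omega> + 1 / real n" if "\<omega> \<in> space M" for \<omega>
      proof -
        have "Y n \<omega> = (\<Sum>k\<in>{1..n}. (1 / real n) * (if real k \<le> real n * X \<omega> then 1 else 0))"
          unfolding Y_def using that by (intro sum.cong) (auto simp: A_def indicator_def)
        then show "Y n \<omega> \<le> X \<omega>" "X \<omega> \<le> Y n \<omega> + 1 / real n"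
          using staircase_approximation[OF b(1)[of \<omega>] b(2)[of \<omega>] n] by simp_all
      qed
      have "l (Y n) \<le> l X" using Y XL low by (intro mono) auto
      moreover have "l X \<le> l (\<lambda>\<omega>. Y n \<omega> + 1 / real n)"
        using Y XL up by (intro mono Linf_closed(2)[OF _ Linf_const]) auto
      then have "l X \<le> l (Y n) + 1 / real n"
        using lD(2)[OF _ Linf_const, of "Y n" "1 / real n"] Y const by simp
      moreover have int: "integrable Q X" "integrable Q (Y n)"
        using Q.Linf_integrable[OF Linf_Q] XL Y by blast+
      then have "integral\<^sup>L Q (Y n) \<le> integral\<^sup>L Q X"
        using low by (intro integral_mono) (auto simp: space_Q)
      moreover have "integral\<^sup>L Q X \<le> (LINT \<omega>|Q. Y n \<omega> + 1 / real n)"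
        using up int by (intro integral_mono) (auto simp: space_Q)
      then have "integral\<^sup>L Q X \<le> integral\<^sup>L Q (Y n) + 1 / real n"
        using int by (simp add: Q.prob_space)
      ultimately show ?thesis using Y[of n] by linarith
    qed
    then have "\<bar>l X - integral\<^sup>L Q X\<bar> \<le> e" if "0 < e" for e
      using nat_approx_posE[OF that] by (smt (verit) of_nat_0_less_iff zero_less_Suc)
    then have "\<bar>l X - integral\<^sup>L Q X\<bar> \<le> 0" by (rule field_le_epsilon) simp
    then show ?thesis by simp
  qed
  have rep: "integral\<^sup>L Q X = l X" if X: "X \<in> Linf M" for X
  proof -
    obtain c0 where "AE \<omega> in M. \<bar>X \<omega>\<bar> \<le> c0" using X by (auto simp: Linf_def)
    define c where "c = \<bar>c0\<bar> + 1"
    have c: "0 < c" "AE \<omega> in M. \<bar>X \<omega>\<bar> \<le> c"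
      using \<open>AE \<omega> in M. \<bar>X \<omega>\<bar> \<le> c0\<close> by (auto simp: c_def elim!: eventually_mono)
    \<comment> \<open>The factor 3 instead of 2 keeps the values strictly below 1.\<close>
    define Y where "Y \<omega> = (max (- c) (min c (X \<omega>)) + c) / (3 * c)" for \<omega>
    have Xm: "X \<in> borel_measurable M" using X by (simp add: Linf_def)
    have Y_meas: "Y \<in> borel_measurable M" unfolding Y_def using Xm by measurable
    have Y0: "0 \<le> Y \<omega>" "Y \<omega> < 1" for \<omega> using c(1) by (auto simp: Y_def field_simps)
    have YL: "Y \<in> Linf M" using Y_meas Y0 by (auto simp: Linf_def intro!: exI[of _ 1] less_imp_le)
    have XY: "AE \<omega> in M. X \<omega> = 3 * c * Y \<omega> + (- c) * 1"
      using c(2)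
    proof eventually_elim
      case (elim \<omega>)
      then have "max (- c) (min c (X \<omega>)) = X \<omega>" by auto
      then show ?case using c(1) by (simp add: Y_def)
    qed
    have "l X = l (\<lambda>\<omega>. 3 * c * Y \<omega> + (- c) * 1)"
      using XY by (intro cong X Linf_closed(1)[OF YL Linf_const])
    also have "\<dots> = 3 * c * l Y - c" using lD(1)[OF YL Linf_const, of "3 * c" "- c" 1] norm by simp
    finally have 1: "l X = 3 * c * l Y - c" .
    have iY: "integrable Q Y" using Q.Linf_integrable[OF Linf_Q[OF YL]] .
    have "integral\<^sup>L Q X = (LINT \<omega>|Q. 3 * c * Y \<omega> + (- c) * 1)"
      using absolutely_continuous_AE[OF sets_Q ac XY] Xm Y_meas by (intro integral_cong_AE) auto
    also have "\<dots> = 3 * c * integral\<^sup>L Q Y - c" using iY by (simp add: Q.prob_space)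
    finally show ?thesis using 1 rep1[OF Y_meas Y0] by simp
  qed
  show thesis using that[OF Q] rep by blast
qed

section \<open>Measures that attain the minimax value\<close>

text \<open>
The functional that supports \<open>\<rho>\<close> over the absorbing enlargement \<open>C\<close> of \<open>S\<close> is bounded below on
\<open>C\<close>. Since \<open>Z0 - j 1\<^sub>A\<close> lies in \<open>C\<close> for small \<open>A\<close>, the value at \<open>1\<^sub>A\<close> is at most a constant
divided by \<open>j\<close>, which is the continuity needed to represent the functional by a measure.
\<close>

lemma (in lsc_convex_expectation) approximate_minimizing_measure:
  assumes S: "bounded_closed_convex M S" "S \<noteq> {}" and m: "\<And>Z. Z \<in> S \<Longrightarrow> m \<le> \<rho> Z" and e: "0 < e"
  shows "\<exists>Q\<in>ac_prob_measures M. \<forall>W\<in>Linf M. \<forall>Z\<in>S.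
    (LINT \<omega>|Q. W \<omega>) - \<rho> W \<le> (LINT \<omega>|Q. Z \<omega>) - m + e"
proof -
  define d where "d = m - e"
  have gap: "d < \<rho> Z" if "Z \<in> S" for Z using m[OF that] e by (simp add: d_def)
  obtain C where C: "S \<subseteq> C" "C \<subseteq> Linf M" "convex_functions C" "\<And>Z. Z \<in> C \<Longrightarrow> d < \<rho> Z"
    and abs: "\<And>j::nat. \<exists>\<eta>>0. \<forall>A\<in>sets M. prob A \<le> \<eta> \<longrightarrow>
       (\<forall>Z\<in>S. (\<lambda>\<omega>. Z \<omega> - real j * indicator A \<omega>) \<in> C)"
    using absorbing_enlargement[OF S(1) gap] by metis
  obtain Z0 where Z0: "Z0 \<in> S" using S(2) by blast
  then have Z0L: "Z0 \<in> Linf M" using C by blast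
  obtain l where lin: "linear_on (Linf M) l"
    and l: "\<And>W Z. W \<in> Linf M \<Longrightarrow> Z \<in> C \<Longrightarrow> l W - \<rho> W \<le> l Z - d"
    using supporting_functional[of C d] C S(2) by (metis bot.extremum_uniqueI less_imp_le)
  define K where "K = l Z0 - d"
  have K: "l W \<le> \<rho> W + K" if "W \<in> Linf M" for W using l[OF that, of Z0] C(1) Z0 by (auto simp: K_def)
  have pos: "0 \<le> l X" if "X \<in> Linf M" "AE \<omega> in M. 0 \<le> X \<omega>" for X
    using dominated_functional_positive[OF lin, of K X] K that by blast
  have norm: "l (\<lambda>_. 1) = 1" using dominated_functional_normalized[OF lin, of K] K by blast
  have small: "\<exists>\<eta>>0. \<forall>A\<in>sets M. prob A \<le> \<eta> \<longrightarrow> l (indicator A) \<le> \<delta>" if "0 < \<delta>" for \<delta>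
  proof -
    obtain i where "(K + \<rho> (\<lambda>_. 0)) / \<delta> < real i" using reals_Archimedean2 by blast
    moreover define j where "j = Suc i"
    ultimately have j: "(K + \<rho> (\<lambda>_. 0)) / \<delta> < real j" "0 < j" by auto
    obtain \<eta> where \<eta>: "\<eta> > 0" "\<And>A. A \<in> sets M \<Longrightarrow> prob A \<le> \<eta> \<Longrightarrow>
        (\<lambda>\<omega>. Z0 \<omega> - real j * indicator A \<omega>) \<in> C" using abs[of j] Z0 by blast
    have "l (indicator A) \<le> \<delta>" if A: "A \<in> sets M" "prob A \<le> \<eta>" for A
    proof -
      have "l (\<lambda>_. 0) - \<rho> (\<lambda>_. 0) \<le> l (\<lambda>\<omega>. Z0 \<omega> - real j * indicator A \<omega>) - d"
        using l[OF Linf_const \<eta>(2)[OF A]] .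
      then have "real j * l (indicator A) \<le> K + \<rho> (\<lambda>_. 0)"
        using linear_onD(6)[OF lin Z0L Linf_indicator[OF A(1)], of "real j"] linear_onD(7)[OF lin Z0L Z0L]
        by (simp add: K_def)
      also have "\<dots> \<le> real j * \<delta>" using j \<open>0 < \<delta>\<close> by (simp add: field_simps)
      finally show ?thesis using j(2) by simp
    qed
    then show ?thesis using \<eta>(1) by blast
  qed
  obtain Q where Q: "Q \<in> ac_prob_measures M" "\<And>X. X \<in> Linf M \<Longrightarrow> (LINT \<omega>|Q. X \<omega>) = l X"
    using linear_functional_representation[OF lin pos norm small] by blast
  show ?thesis
  proof (intro bexI[OF _ Q(1)] ballI)
    fix W Z assume W: "W \<in> Linf M" and Z: "Z \<in> S"
    then have "Z \<in> C" "Z \<in> Linf M" using C by auto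
    then show "(LINT \<omega>|Q. W \<omega>) - \<rho> W \<le> (LINT \<omega>|Q. Z \<omega>) - m + e"
      using l[OF W, of Z] Q(2)[OF W] Q(2)[of Z] by (simp add: d_def)
  qed
qed

lemma (in prob_space) ac_prob_measure_integrable:
  assumes Q: "Q \<in> ac_prob_measures M" and X: "X \<in> Linf M"
  shows "integrable Q X"
proof -
  from Q have *: "prob_space Q" "sets Q = sets M" "absolutely_continuous M Q"
    by (auto simp: ac_prob_measures_def)
  have "X \<in> Linf Q"
    using X absolutely_continuous_AE[OF *(2,3)]
    unfolding Linf_def measurable_cong_sets[OF *(2) refl] by blast
  with *(1) show ?thesis by (rule prob_space.Linf_integrable)
qed

lemma integrable_mult_Linf:
  fixes F X :: "'a \<Rightarrow> real"
  assumes F: "integrable M F" and X: "X \<in> Linf M"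
  shows "integrable M (\<lambda>\<omega>. F \<omega> * X \<omega>)"
proof -
  obtain c where c: "AE \<omega> in M. \<bar>X \<omega>\<bar> \<le> c" using X by (auto simp: Linf_def)
  show ?thesis
  proof (rule Bochner_Integration.integrable_bound)
    show "integrable M (\<lambda>\<omega>. c * F \<omega>)" using F by simp
    show "AE \<omega> in M. norm (F \<omega> * X \<omega>) \<le> norm (c * F \<omega>)"
      using c
    proof eventually_elim
      case (elim \<omega>)
      then have "\<bar>F \<omega>\<bar> * \<bar>X \<omega>\<bar> \<le> \<bar>F \<omega>\<bar> * \<bar>c\<bar>" by (intro mult_left_mono) auto
      then show ?case by (simp add: abs_mult mult.commute)
    qed
  qed (use F X in \<open>auto simp: Linf_def\<close>)
qed

lemma (in prob_space) ac_prob_measure_density: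
  assumes Q: "Q \<in> ac_prob_measures M"
  shows "integrable M (\<lambda>\<omega>. enn2real (RN_deriv M Q \<omega>))"
    and "X \<in> borel_measurable M \<Longrightarrow> (LINT \<omega>|M. enn2real (RN_deriv M Q \<omega>) * X \<omega>) = (LINT \<omega>|Q. X \<omega>)"
proof -
  from Q have *: "prob_space Q" "sets Q = sets M" "absolutely_continuous M Q"
    by (auto simp: ac_prob_measures_def)
  interpret Q: prob_space Q by fact
  have sf: "sigma_finite_measure Q" by unfold_locales
  show "integrable M (\<lambda>\<omega>. enn2real (RN_deriv M Q \<omega>))"
    using RN_deriv_integrable[OF sf *(3,2), of "\<lambda>_. 1"] by simp
  show "X \<in> borel_measurable M \<Longrightarrow> (LINT \<omega>|M. enn2real (RN_deriv M Q \<omega>) * X \<omega>) = (LINT \<omega>|Q. X \<omega>)"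
    using RN_deriv_integral[OF sf *(3,2)] by simp
qed

lemma (in prob_space) penalty_level_densityI:
  assumes G: "integrable M G" "\<And>\<omega>. 0 \<le> G \<omega>" "expectation G = 1"
    and le: "\<And>X. X \<in> Linf M \<Longrightarrow> (LINT \<omega>|M. G \<omega> * X \<omega>) - \<rho> X \<le> c"
  shows "G \<in> penalty_level_densities M \<rho> c"
proof -
  have Gm [measurable]: "G \<in> borel_measurable M" using G by auto
  define Q where "Q = density M (\<lambda>\<omega>. ennreal (G \<omega>))"
  have "emeasure Q (space M) = (\<integral>\<^sup>+\<omega>. ennreal (G \<omega>) \<partial>M)"
    by (auto simp: Q_def emeasure_density cong: nn_integral_cong_simp)
  also have "\<dots> = 1" using nn_integral_eq_integral[OF G(1)] G by simp
  finally have "prob_space Q" by (intro prob_spaceI) (simp add: Q_def)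
  moreover have "absolutely_continuous M Q"
    unfolding Q_def by (intro absolutely_continuousI_density) measurable
  ultimately have Q: "Q \<in> ac_prob_measures M" by (simp add: ac_prob_measures_def Q_def)
  have int: "(LINT \<omega>|Q. X \<omega>) = (LINT \<omega>|M. G \<omega> * X \<omega>)" if "X \<in> borel_measurable M" for X
    unfolding Q_def using that G(2) by (subst integral_density) auto
  have pen: "penalty M \<rho> Q \<le> ereal c"
    unfolding penalty_def
  proof (rule SUP_least)
    fix X assume "X \<in> Linf M"
    then show "ereal ((LINT \<omega>|Q. X \<omega>) - \<rho> X) \<le> ereal c"
      using le[of X] int[of X] by (simp add: Linf_def)
  qed
  then have "Q \<in> finite_penalty_measures M \<rho>" using Q by (auto simp: finite_penalty_measures_def)
  moreover have "AE \<omega> in M. ennreal (G \<omega>) = RN_deriv M Q \<omega>"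
    by (rule RN_deriv_unique) (auto simp: Q_def)
  then have "AE \<omega> in M. G \<omega> = enn2real (RN_deriv M Q \<omega>)"
    by eventually_elim (use G(2) in \<open>metis enn2real_ennreal\<close>)
  ultimately show ?thesis unfolding penalty_level_densities_def using pen by auto
qed

text \<open>
Probability densities that converge a.e. to a probability density converge in \<open>L\<^sup>1\<close> by
Scheffe's lemma.
\<close>

lemma (in prob_space) L1_limit_expectation:
  assumes G: "\<And>n. integrable M (G n)" "\<And>n \<omega>. 0 \<le> G n \<omega>" "\<And>n. expectation (G n) = 1"
    and H: "integrable M H" "AE \<omega> in M. 0 \<le> H \<omega>" "expectation H = 1"
    and lim: "AE \<omega> in M. (\<lambda>n. G n \<omega>) \<longlonglongrightarrow> H \<omega>" and X: "X \<in> Linf M"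
  shows "(\<lambda>n. expectation (\<lambda>\<omega>. G n \<omega> * X \<omega>)) \<longlonglongrightarrow> expectation (\<lambda>\<omega>. H \<omega> * X \<omega>)"
proof -
  obtain c where c: "AE \<omega> in M. \<bar>X \<omega>\<bar> \<le> c" using X by (auto simp: Linf_def)
  have [measurable]: "X \<in> borel_measurable M" "G n \<in> borel_measurable M" "H \<in> borel_measurable M" for n
    using X G H by (auto simp: Linf_def)
  have "(\<integral>\<^sup>+\<omega>. norm (G n \<omega>) \<partial>M) \<le> (\<integral>\<^sup>+\<omega>. norm (H \<omega>) \<partial>M)" for n
  proof -
    have "(\<integral>\<^sup>+\<omega>. norm (G n \<omega>) \<partial>M) = 1"
      using nn_integral_eq_integral[OF G(1)[of n]] G by simp
    moreover have "(\<integral>\<^sup>+\<omega>. norm (H \<omega>) \<partial>M) = (\<integral>\<^sup>+\<omega>. ennreal (H \<omega>) \<partial>M)"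
      using H(2) by (intro nn_integral_cong_AE) auto
    moreover have "\<dots> = 1" using nn_integral_eq_integral[OF H(1,2)] H(3) by simp
    ultimately show ?thesis by simp
  qed
  then have L1: "(\<lambda>n. \<integral>\<^sup>+\<omega>. norm (G n \<omega> - H \<omega>) \<partial>M) \<longlonglongrightarrow> 0"
    by (intro Scheffe_lemma2 H lim) auto
  have "(\<lambda>n. \<integral>\<^sup>+\<omega>. norm (G n \<omega> * X \<omega> - H \<omega> * X \<omega>) \<partial>M) \<longlonglongrightarrow> 0"
  proof (rule tendsto_sandwich[OF _ _ tendsto_const])
    show "\<forall>\<^sub>F n in sequentially. (\<integral>\<^sup>+\<omega>. norm (G n \<omega> * X \<omega> - H \<omega> * X \<omega>) \<partial>M) \<le>
        ennreal \<bar>c\<bar> * (\<integral>\<^sup>+\<omega>. norm (G n \<omega> - H \<omega>) \<partial>M)"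
    proof (intro always_eventually allI)
      fix n
      have "(\<integral>\<^sup>+\<omega>. norm (G n \<omega> * X \<omega> - H \<omega> * X \<omega>) \<partial>M) \<le>
          (\<integral>\<^sup>+\<omega>. ennreal \<bar>c\<bar> * norm (G n \<omega> - H \<omega>) \<partial>M)"
      proof (rule nn_integral_mono_AE)
        show "AE \<omega> in M. ennreal (norm (G n \<omega> * X \<omega> - H \<omega> * X \<omega>)) \<le> ennreal \<bar>c\<bar> * ennreal (norm (G n \<omega> - H \<omega>))"
          using c
        proof eventually_elim
          case (elim \<omega>)
          have "\<bar>X \<omega>\<bar> * \<bar>G n \<omega> - H \<omega>\<bar> \<le> \<bar>c\<bar> * \<bar>G n \<omega> - H \<omega>\<bar>"
            using elim by (intro mult_right_mono) auto
          then show ?case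
            by (simp flip: ennreal_mult left_diff_distrib add: abs_mult mult.commute[of _ "\<bar>X \<omega>\<bar>"] ennreal_leI)
        qed
      qed
      also have "\<dots> = ennreal \<bar>c\<bar> * (\<integral>\<^sup>+\<omega>. norm (G n \<omega> - H \<omega>) \<partial>M)"
        by (rule nn_integral_cmult) measurable
      finally show "(\<integral>\<^sup>+\<omega>. norm (G n \<omega> * X \<omega> - H \<omega> * X \<omega>) \<partial>M) \<le>
        ennreal \<bar>c\<bar> * (\<integral>\<^sup>+\<omega>. norm (G n \<omega> - H \<omega>) \<partial>M)" .
    qed
    show "(\<lambda>n. ennreal \<bar>c\<bar> * (\<integral>\<^sup>+\<omega>. norm (G n \<omega> - H \<omega>) \<partial>M)) \<longlonglongrightarrow> 0"
      using ennreal_tendsto_cmult[OF _ L1, of "ennreal \<bar>c\<bar>"] by simp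
  qed auto
  then show ?thesis by (intro tendsto_L1_int integrable_mult_Linf G H X)
qed

text \<open>
The defining inequality of the approximate minimizers is linear in the density and its error
decreases, so averages of tails of the densities satisfy it too. Tested with \<open>Z0\<close> it bounds the penalty
by \<open>b - m + 1\<close>, which places the averages in the closed level set. Closedness guarantees that the a.e.
limit has integral one.
\<close>

lemma (in lsc_convex_expectation) minimizing_measure:
  assumes S: "bounded_closed_convex M S" and m: "\<And>Z. Z \<in> S \<Longrightarrow> m \<le> \<rho> Z"
    and Z0: "Z0 \<in> S" "AE \<omega> in M. Z0 \<omega> \<le> b" and v: "b - m + 1 \<le> v"
    and closed: "closed_under_ae_convergence M (penalty_level_densities M \<rho> v)"
  obtains Q where "Q \<in> finite_penalty_measures M \<rho>"
    "\<And>W Z. W \<in> Linf M \<Longrightarrow> Z \<in> S \<Longrightarrow> (LINT \<omega>|Q. W \<omega>) - \<rho> W \<le> (LINT \<omega>|Q. Z \<omega>) - m"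
proof -
  have SL: "S \<subseteq> Linf M" by (rule bounded_closed_convex_subset_Linf[OF S])
  have "\<exists>Q\<in>ac_prob_measures M. \<forall>W\<in>Linf M. \<forall>Z\<in>S.
      (LINT \<omega>|Q. W \<omega>) - \<rho> W \<le> (LINT \<omega>|Q. Z \<omega>) - m + 1 / real (Suc n)" for n
    using approximate_minimizing_measure[OF S, of m "1 / real (Suc n)"] m Z0(1) by auto
  then obtain Q where Q_all: "\<And>n. Q n \<in> ac_prob_measures M \<and> (\<forall>W\<in>Linf M. \<forall>Z\<in>S.
      (LINT \<omega>|Q n. W \<omega>) - \<rho> W \<le> (LINT \<omega>|Q n. Z \<omega>) - m + 1 / real (Suc n))"
    unfolding Bex_def by metis
  then have Q: "Q n \<in> ac_prob_measures M" for n by blast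
  have Q_le: "(LINT \<omega>|Q n. W \<omega>) - \<rho> W \<le> (LINT \<omega>|Q n. Z \<omega>) - m + 1 / real (Suc n)"
    if "W \<in> Linf M" "Z \<in> S" for n W Z using Q_all that by blast
  define G where "G n \<omega> = enn2real (RN_deriv M (Q n) \<omega>)" for n \<omega>
  have G_int: "integrable M (G n)" for n
    unfolding G_def using ac_prob_measure_density(1)[OF Q] .
  have G_nonneg: "0 \<le> G n \<omega>" for n \<omega> by (simp add: G_def)
  have G_exp: "(LINT \<omega>|M. G n \<omega> * X \<omega>) = (LINT \<omega>|Q n. X \<omega>)" if "X \<in> Linf M" for n X
    unfolding G_def using ac_prob_measure_density(2)[OF Q] that by (simp add: Linf_def)
  have Q_prob: "prob_space (Q n)" for n using Q[of n] by (simp add: ac_prob_measures_def)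
  have Q_ac: "sets (Q n) = sets M" "absolutely_continuous M (Q n)" for n
    using Q[of n] by (auto simp: ac_prob_measures_def)
  have int_Q: "integrable (Q n) X" if "X \<in> Linf M" for X n
    using ac_prob_measure_integrable[OF Q that] .
  have G_one: "expectation (G n) = 1" for n
    using G_exp[OF Linf_const, of n 1] prob_space.prob_space[OF Q_prob[of n]] by simp
  \<comment> \<open>This bounds the penalty of every approximate minimizer by \<open>v\<close>.\<close>
  have G_pen: "(LINT \<omega>|M. G n \<omega> * W \<omega>) - \<rho> W \<le> v" if W: "W \<in> Linf M" for n W
  proof -
    have "(LINT \<omega>|Q n. Z0 \<omega>) \<le> (LINT \<omega>|Q n. b)"
      using Z0(1) SL absolutely_continuous_AE[OF Q_ac[of n] Z0(2)] int_Q[OF Linf_const[of b]] int_Q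
      by (intro integral_mono_AE) auto
    then have "(LINT \<omega>|Q n. Z0 \<omega>) \<le> b" using prob_space.prob_space[OF Q_prob[of n]] by simp
    moreover have "1 / real (Suc n) \<le> 1" by simp
    ultimately show ?thesis using Q_le[OF W Z0(1), of n] v G_exp[OF W, of n] by linarith
  qed
  have G_le: "(LINT \<omega>|M. G n \<omega> * (W \<omega> - Z \<omega>)) \<le> \<rho> W - m + 1 / real (Suc n)"
    if W: "W \<in> Linf M" and Z: "Z \<in> S" for n W Z
  proof -
    have "(LINT \<omega>|M. G n \<omega> * (W \<omega> - Z \<omega>)) = (LINT \<omega>|Q n. W \<omega> - Z \<omega>)"
      using G_exp[OF Linf_closed(4)[of W M Z]] W Z SL by blast
    also have "\<dots> = (LINT \<omega>|Q n. W \<omega>) - (LINT \<omega>|Q n. Z \<omega>)"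
      using int_Q W Z SL by (intro Bochner_Integration.integral_diff) auto
    finally show ?thesis using Q_le[OF W Z, of n] by linarith
  qed
  have GX_int: "integrable M (\<lambda>\<omega>. G n \<omega> * X \<omega>)" if "X \<in> Linf M" for n X
    using integrable_mult_Linf[OF G_int that] .
  obtain T H where T: "\<And>n. tail_average n (T n)" and Hm: "H \<in> borel_measurable M"
    and lim: "AE \<omega> in M. (\<lambda>n. T n (\<lambda>k. G k \<omega>)) \<longlonglongrightarrow> H \<omega>"
    using komlos_nonneg[of G 1] G_int G_nonneg G_one by auto
  define F where "F n \<omega> = T n (\<lambda>k. G k \<omega>)" for n \<omega>
  have F_int: "integrable M (F n)" for n
    unfolding F_def using tail_average_integral(1)[OF T[of n], of M G] G_int by blast
  have F_nonneg: "0 \<le> F n \<omega>" for n \<omega>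
    unfolding F_def by (intro tail_average_ge[OF T] G_nonneg)
  have F_exp: "(LINT \<omega>|M. F n \<omega> * X \<omega>) = T n (\<lambda>k. LINT \<omega>|M. G k \<omega> * X \<omega>)" if "X \<in> Linf M" for n X
  proof -
    have "F n \<omega> * X \<omega> = T n (\<lambda>k. G k \<omega> * X \<omega>)" for \<omega>
      using tail_average_linear[OF T[of n], of "X \<omega>" "\<lambda>k. G k \<omega>" 0 "\<lambda>k. 0" 0]
      by (simp add: F_def mult.commute)
    then show ?thesis
      using tail_average_integral(2)[OF T[of n], of M "\<lambda>k \<omega>. G k \<omega> * X \<omega>"] GX_int[OF that] by simp
  qed
  have F_one: "expectation (F n) = 1" for n
    using F_exp[OF Linf_const, of n 1] G_one tail_average_const[OF T[of n]] by simp
  have F_level: "F n \<in> penalty_level_densities M \<rho> v" for n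
  proof (rule penalty_level_densityI[OF F_int F_nonneg F_one])
    fix X assume X: "X \<in> Linf M"
    have "T n (\<lambda>k. LINT \<omega>|M. G k \<omega> * X \<omega>) \<le> v + \<rho> X"
      using G_pen[OF X] by (intro tail_average_le[OF T]) (simp add: diff_le_eq)
    then show "(LINT \<omega>|M. F n \<omega> * X \<omega>) - \<rho> X \<le> v" using F_exp[OF X] by simp
  qed
  have limF: "AE \<omega> in M. (\<lambda>n. F n \<omega>) \<longlonglongrightarrow> H \<omega>" using lim by (simp add: F_def)
  have "H \<in> penalty_level_densities M \<rho> v"
    using closed_under_ae_convergenceD[OF closed F_level Hm limF] .
  then obtain P where P: "P \<in> finite_penalty_measures M \<rho>"
    and HP: "AE \<omega> in M. H \<omega> = enn2real (RN_deriv M P \<omega>)"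
    by (auto simp: penalty_level_densities_def)
  have Pac: "P \<in> ac_prob_measures M" using P by (simp add: finite_penalty_measures_def)
  then have P_prob: "prob_space P" and P_ac: "sets P = sets M" "absolutely_continuous M P"
    by (auto simp: ac_prob_measures_def)
  note dens = ac_prob_measure_density[OF Pac]
  have H_exp: "(LINT \<omega>|M. H \<omega> * X \<omega>) = (LINT \<omega>|P. X \<omega>)" if "X \<in> Linf M" for X
  proof -
    have Xm: "X \<in> borel_measurable M" using that by (simp add: Linf_def)
    have "(LINT \<omega>|M. H \<omega> * X \<omega>) = (LINT \<omega>|M. enn2real (RN_deriv M P \<omega>) * X \<omega>)"
      using HP Hm Xm by (intro integral_cong_AE) auto
    then show ?thesis using dens(2)[OF Xm] by simp
  qed
  have H_int: "integrable M H"
    using integrable_cong_AE[of H M "\<lambda>\<omega>. enn2real (RN_deriv M P \<omega>)"] Hm HP dens(1) by simp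
  have H_nonneg: "AE \<omega> in M. 0 \<le> H \<omega>" using HP by eventually_elim simp
  have H_one: "expectation H = 1"
    using H_exp[OF Linf_const, of 1] prob_space.prob_space[OF P_prob] by simp
  have int_P: "integrable P X" if "X \<in> Linf M" for X
    using ac_prob_measure_integrable[OF Pac that] .
  show thesis
  proof (rule that[OF P])
    fix W Z assume W: "W \<in> Linf M" and Z: "Z \<in> S"
    have ZL: "Z \<in> Linf M" using Z SL by blast
    have WZ: "(\<lambda>\<omega>. W \<omega> - Z \<omega>) \<in> Linf M" by (rule Linf_closed(4)[OF W ZL])
    have "expectation (\<lambda>\<omega>. H \<omega> * (W \<omega> - Z \<omega>)) \<le> \<rho> W - m"
    proof (rule LIMSEQ_le)
      show "(\<lambda>n. expectation (\<lambda>\<omega>. F n \<omega> * (W \<omega> - Z \<omega>))) \<longlonglongrightarrow> expectation (\<lambda>\<omega>. H \<omega> * (W \<omega> - Z \<omega>))"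
        by (rule L1_limit_expectation[OF F_int F_nonneg F_one H_int H_nonneg H_one limF WZ])
      have "(\<lambda>n. \<rho> W - m + 1 / real (Suc n)) \<longlonglongrightarrow> \<rho> W - m + 0"
        by (intro tendsto_intros LIMSEQ_Suc[OF lim_1_over_n])
      then show "(\<lambda>n. \<rho> W - m + 1 / real (Suc n)) \<longlonglongrightarrow> \<rho> W - m" by simp
      have "expectation (\<lambda>\<omega>. F n \<omega> * (W \<omega> - Z \<omega>)) \<le> \<rho> W - m + 1 / real (Suc n)" for n
        unfolding F_exp[OF WZ]
      proof (rule tail_average_le[OF T])
        fix k assume "n \<le> k"
        then have "1 / real (Suc k) \<le> 1 / real (Suc n)" by (simp add: frac_le)
        then show "(LINT \<omega>|M. G k \<omega> * (W \<omega> - Z \<omega>)) \<le> \<rho> W - m + 1 / real (Suc n)"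
          using G_le[OF W Z, of k] by linarith
      qed
      then show "\<exists>N. \<forall>n\<ge>N. expectation (\<lambda>\<omega>. F n \<omega> * (W \<omega> - Z \<omega>)) \<le> \<rho> W - m + 1 / real (Suc n)"
        by blast
    qed
    then have "(LINT \<omega>|P. W \<omega> - Z \<omega>) \<le> \<rho> W - m" using H_exp[OF WZ] by simp
    then show "(LINT \<omega>|P. W \<omega>) - \<rho> W \<le> (LINT \<omega>|P. Z \<omega>) - m"
      using int_P[OF W] int_P[OF ZL] by simp
  qed
qed

section \<open>The set of shortfalls and the optimal tests\<close>

lemma (in lsc_convex_expectation) bounded_closed_convex_shortfalls:
  assumes K1: "K1 \<in> Linf M" and K2: "K2 \<in> Linf M"
  shows "bounded_closed_convex M ((\<lambda>X \<omega>. K2 \<omega> - X \<omega>) ` admissible_tests M \<rho> K1 K2 \<alpha>)"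
  unfolding bounded_closed_convex_def
proof (intro conjI)
  let ?A = "admissible_tests M \<rho> K1 K2 \<alpha>"
  let ?S = "(\<lambda>X \<omega>. K2 \<omega> - X \<omega>) ` ?A"
  obtain c1 c2 where c1: "AE \<omega> in M. \<bar>K1 \<omega>\<bar> \<le> c1" and c2: "AE \<omega> in M. \<bar>K2 \<omega>\<bar> \<le> c2"
    using K1 K2 by (auto simp: Linf_def)
  have A_L: "X \<in> Linf M" and A_b: "AE \<omega> in M. K1 \<omega> \<le> X \<omega> \<and> X \<omega> \<le> K2 \<omega>" and A_r: "\<rho> X \<le> \<alpha>"
    if "X \<in> ?A" for X using that by (auto simp: admissible_tests_def)
  have A_bound: "AE \<omega> in M. \<bar>X \<omega>\<bar> \<le> \<bar>c1\<bar> + \<bar>c2\<bar>" if "X \<in> ?A" for X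
    using A_b[OF that] c1 c2 by eventually_elim linarith
  show "?S \<subseteq> borel_measurable M"
    using Linf_closed(4)[OF K2 A_L] by (auto simp: Linf_def)
  show "convex_functions ?S"
    unfolding convex_functions_def
  proof (intro ballI)
    fix Y Z and l :: real assume "Y \<in> ?S" "Z \<in> ?S" and l: "l \<in> {0..1}"
    then obtain X W where X: "X \<in> ?A" "Y = (\<lambda>\<omega>. K2 \<omega> - X \<omega>)" and W: "W \<in> ?A" "Z = (\<lambda>\<omega>. K2 \<omega> - W \<omega>)" by blast
    define V where "V \<omega> = l * X \<omega> + (1 - l) * W \<omega>" for \<omega>
    have "AE \<omega> in M. K1 \<omega> \<le> V \<omega> \<and> V \<omega> \<le> K2 \<omega>"
      using A_b[OF X(1)] A_b[OF W(1)]
    proof eventually_elim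
      case (elim \<omega>)
      have "- (l * X \<omega> + (1 - l) * W \<omega>) = l * (- X \<omega>) + (1 - l) * (- W \<omega>)" by (simp add: algebra_simps)
      moreover have "l * (- X \<omega>) + (1 - l) * (- W \<omega>) \<le> - K1 \<omega>"
        using elim l by (intro convex_bound_le) auto
      moreover have "l * X \<omega> + (1 - l) * W \<omega> \<le> K2 \<omega>"
        using elim l by (intro convex_bound_le) auto
      ultimately show ?case by (simp add: V_def)
    qed
    moreover have "V \<in> Linf M"
      unfolding V_def[abs_def] by (rule Linf_closed(1)[OF A_L[OF X(1)] A_L[OF W(1)]])
    moreover have "\<rho> V \<le> \<alpha>"
    proof -
      have "\<rho> V \<le> l * \<rho> X + (1 - l) * \<rho> W"
        unfolding V_def[abs_def] using rho_convex[OF A_L[OF X(1)] A_L[OF W(1)]] l by simp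
      also have "\<dots> \<le> \<alpha>" using A_r[OF X(1)] A_r[OF W(1)] l by (intro convex_bound_le) auto
      finally show ?thesis .
    qed
    ultimately have "V \<in> ?A" by (simp add: admissible_tests_def)
    moreover have "(\<lambda>\<omega>. l * Y \<omega> + (1 - l) * Z \<omega>) = (\<lambda>\<omega>. K2 \<omega> - V \<omega>)"
      unfolding X(2) W(2) V_def by (intro ext) (simp add: algebra_simps)
    ultimately show "(\<lambda>\<omega>. l * Y \<omega> + (1 - l) * Z \<omega>) \<in> ?S" by simp
  qed
  show "\<exists>c. \<forall>Z\<in>?S. AE \<omega> in M. \<bar>Z \<omega>\<bar> \<le> c"
  proof (intro exI ballI)
    fix Z assume "Z \<in> ?S"
    then obtain X where X: "X \<in> ?A" "Z = (\<lambda>\<omega>. K2 \<omega> - X \<omega>)" by blast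
    show "AE \<omega> in M. \<bar>Z \<omega>\<bar> \<le> \<bar>c1\<bar> + 2 * \<bar>c2\<bar>"
      using A_bound[OF X(1)] c2 by eventually_elim (simp add: X(2))
  qed
  show "closed_under_ae_convergence M ?S"
    unfolding closed_under_ae_convergence_def
  proof (intro allI impI)
    fix Ys Y assume Ys: "\<forall>n. Ys n \<in> ?S" and Y: "Y \<in> borel_measurable M"
      and lim: "AE \<omega> in M. (\<lambda>n. Ys n \<omega>) \<longlonglongrightarrow> Y \<omega>"
    define X where "X n \<omega> = K2 \<omega> - Ys n \<omega>" for n \<omega>
    have XA: "X n \<in> ?A" for n
    proof -
      obtain X' where "X' \<in> ?A" "Ys n = (\<lambda>\<omega>. K2 \<omega> - X' \<omega>)" using Ys by blast
      then show ?thesis by (simp add: X_def[abs_def])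
    qed
    define V where "V \<omega> = K2 \<omega> - Y \<omega>" for \<omega>
    have Vm: "V \<in> borel_measurable M" unfolding V_def using K2 Y by (auto simp: Linf_def)
    have limX: "AE \<omega> in M. (\<lambda>n. X n \<omega>) \<longlonglongrightarrow> V \<omega>"
      using lim unfolding X_def V_def by eventually_elim (intro tendsto_intros)
    have Xb: "AE \<omega> in M. \<forall>n. K1 \<omega> \<le> X n \<omega> \<and> X n \<omega> \<le> K2 \<omega>"
      using A_b[OF XA] by (simp add: AE_all_countable)
    have Vb: "AE \<omega> in M. K1 \<omega> \<le> V \<omega> \<and> V \<omega> \<le> K2 \<omega>"
      using limX Xb
    proof eventually_elim
      case (elim \<omega>)
      then show ?case using LIMSEQ_le_const[OF elim(1), of "K1 \<omega>"] LIMSEQ_le_const2[OF elim(1), of "K2 \<omega>"] by blast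
    qed
    have "AE \<omega> in M. \<bar>V \<omega>\<bar> \<le> \<bar>c1\<bar> + \<bar>c2\<bar>" using Vb c1 c2 by eventually_elim linarith
    then have VL: "V \<in> Linf M" using Vm by (auto simp: Linf_def)
    have "X n \<in> borel_measurable M" for n using A_L[OF XA] by (simp add: Linf_def)
    then have "\<rho> V \<le> \<alpha>"
      using rho_fatou[of X "\<bar>c1\<bar> + \<bar>c2\<bar>" V \<alpha>] A_bound[OF XA] Vm limX A_r[OF XA] by blast
    with VL Vb have "V \<in> ?A" by (simp add: admissible_tests_def)
    moreover have "Y = (\<lambda>\<omega>. K2 \<omega> - V \<omega>)" by (auto simp: V_def)
    ultimately show "Y \<in> ?S" by blast
  qed
qed

text \<open>
The bound is obtained with \<open>real_of_ereal\<close>, which sends infinite values to zero, so the essential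
supremum must first be shown to be finite.
\<close>

lemma AE_le_least_ess_upper_bound:
  assumes "prob_space \<mu>" "K1 \<in> Linf \<mu>" "K2 \<in> Linf \<mu>"
  shows "AE \<omega> in \<mu>. K2 \<omega> \<le> least_ess_upper_bound \<mu> K1 K2"
proof -
  interpret prob_space \<mu> by fact
  define f where "f \<omega> = ereal (max (K1 \<omega>) (K2 \<omega>))" for \<omega>
  obtain c1 c2 where c1: "AE \<omega> in \<mu>. \<bar>K1 \<omega>\<bar> \<le> c1" and c2: "AE \<omega> in \<mu>. \<bar>K2 \<omega>\<bar> \<le> c2"
    using assms by (auto simp: Linf_def)
  have fm: "f \<in> borel_measurable \<mu>" unfolding f_def using assms by (auto simp: Linf_def)
  have "AE \<omega> in \<mu>. f \<omega> \<le> ereal (max c1 c2)"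
    using c1 c2 by eventually_elim (auto simp: f_def max_def)
  then have "esssup \<mu> f \<le> ereal (max c1 c2)" using fm by (intro esssup_I)
  then have upper: "esssup \<mu> f \<noteq> \<infinity>" by (auto simp: max_def split: if_splits simp del: ereal_max)
  have "AE \<omega> in \<mu>. ereal (- c2) \<le> esssup \<mu> f"
    using esssup_AE[of f \<mu>] c2
  proof eventually_elim
    case (elim \<omega>)
    have "- c2 \<le> max (K1 \<omega>) (K2 \<omega>)" using elim(2) by auto
    then have "ereal (- c2) \<le> f \<omega>" unfolding f_def by (simp only: ereal_less_eq)
    then show ?case using elim(1) by (rule order_trans)
  qed
  then have "ereal (- c2) \<le> esssup \<mu> f" by simp
  with upper obtain s where s: "esssup \<mu> f = ereal s" by (cases "esssup \<mu> f") auto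
  have "AE \<omega> in \<mu>. K2 \<omega> \<le> s"
    using esssup_AE[of f \<mu>] by eventually_elim (simp add: s f_def)
  then show ?thesis using s by (simp add: least_ess_upper_bound_def f_def[abs_def])
qed

theorem theorem4p2:
  fixes \<mu> :: "'a measure"
    and \<rho>1 \<rho>2 :: "('a \<Rightarrow> real) \<Rightarrow> real"
    and K1 K2 :: "'a \<Rightarrow> real"
    and \<alpha> u v :: real
  assumes "prob_space \<mu>"
    and "convex_expectation \<mu> \<rho>1" and "convex_expectation \<mu> \<rho>2"
    and "continuous_from_below \<mu> \<rho>1" and "continuous_from_below \<mu> \<rho>2"
    and "K1 \<in> Linf \<mu>" and "K2 \<in> Linf \<mu>"
    and "AE \<omega> in \<mu>. 0 \<le> K1 \<omega> \<and> K1 \<omega> < K2 \<omega>"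
    and "\<rho>1 K1 \<le> \<alpha>" and "\<alpha> \<le> \<rho>1 K2"
    and "u > max 0 (least_ess_upper_bound \<mu> K1 K2 - \<rho>1 (\<lambda>_. 0) + 1)"
    and "v > max 0 (least_ess_upper_bound \<mu> K1 K2 - \<rho>2 (\<lambda>_. 0) + 1)"
    and "closed_under_ae_convergence \<mu> (penalty_level_densities \<mu> \<rho>1 u)"
    and "closed_under_ae_convergence \<mu> (penalty_level_densities \<mu> \<rho>2 v)"
  shows "\<exists>Q\<in>finite_penalty_measures \<mu> \<rho>2. \<forall>X'.
           optimal_test \<mu> \<rho>1 \<rho>2 K1 K2 \<alpha> X' \<longrightarrow>
           (LINT \<omega>|Q. K2 \<omega> - X' \<omega>) =
             (INF X\<in>admissible_tests \<mu> \<rho>1 K1 K2 \<alpha>. LINT \<omega>|Q. K2 \<omega> - X \<omega>)"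
proof -
  interpret prob_space \<mu> by fact
  interpret r1: lsc_convex_expectation \<mu> \<rho>1 by unfold_locales fact+
  interpret r2: lsc_convex_expectation \<mu> \<rho>2 by unfold_locales fact+
  define A where "A = admissible_tests \<mu> \<rho>1 K1 K2 \<alpha>"
  define S where "S = (\<lambda>X \<omega>. K2 \<omega> - X \<omega>) ` A"
  define m where "m = (INF X\<in>A. \<rho>2 (\<lambda>\<omega>. K2 \<omega> - X \<omega>))"
  have S: "bounded_closed_convex \<mu> S"
    unfolding S_def A_def by (rule r1.bounded_closed_convex_shortfalls) fact+
  have SL: "S \<subseteq> Linf \<mu>" by (rule bounded_closed_convex_subset_Linf[OF S])
  have "AE \<omega> in \<mu>. K1 \<omega> \<le> K1 \<omega> \<and> K1 \<omega> \<le> K2 \<omega>" using assms(8) by eventually_elim simp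
  then have K1A: "K1 \<in> A" using assms(6,9) by (simp add: A_def admissible_tests_def)
  have lower: "\<rho>2 (\<lambda>_. 0) \<le> \<rho>2 (\<lambda>\<omega>. K2 \<omega> - X \<omega>)" if X: "X \<in> A" for X
  proof (rule r2.rho_mono[OF Linf_const])
    show "(\<lambda>\<omega>. K2 \<omega> - X \<omega>) \<in> Linf \<mu>" using SL X by (auto simp: S_def)
    have "AE \<omega> in \<mu>. K1 \<omega> \<le> X \<omega> \<and> X \<omega> \<le> K2 \<omega>" using X by (simp add: A_def admissible_tests_def)
    then show "AE \<omega> in \<mu>. 0 \<le> K2 \<omega> - X \<omega>" by eventually_elim simp
  qed
  have m_le: "m \<le> \<rho>2 Z" if "Z \<in> S" for Z
    using that lower unfolding m_def S_def by (auto intro!: cINF_lower bdd_belowI2)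
  have m_ge: "\<rho>2 (\<lambda>_. 0) \<le> m" unfolding m_def using K1A lower by (intro cINF_greatest) auto
  define Z0 where "Z0 \<omega> = K2 \<omega> - K1 \<omega>" for \<omega>
  have Z0S: "Z0 \<in> S" using K1A by (auto simp: S_def Z0_def[abs_def])
  have Z0_le: "AE \<omega> in \<mu>. Z0 \<omega> \<le> least_ess_upper_bound \<mu> K1 K2"
    using AE_le_least_ess_upper_bound[OF assms(1,6,7)] assms(8)
    by eventually_elim (simp add: Z0_def)
  have v: "least_ess_upper_bound \<mu> K1 K2 - m + 1 \<le> v" using assms(12) m_ge by simp
  obtain Q where Q: "Q \<in> finite_penalty_measures \<mu> \<rho>2"
    and Q_le: "\<And>W Z. W \<in> Linf \<mu> \<Longrightarrow> Z \<in> S \<Longrightarrow> (LINT \<omega>|Q. W \<omega>) - \<rho>2 W \<le> (LINT \<omega>|Q. Z \<omega>) - m"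
    using r2.minimizing_measure[OF S m_le Z0S Z0_le v assms(14)] by blast
  show ?thesis
  proof (intro bexI[OF _ Q] allI impI)
    fix X' assume "optimal_test \<mu> \<rho>1 \<rho>2 K1 K2 \<alpha> X'"
    then have X': "X' \<in> A" "\<rho>2 (\<lambda>\<omega>. K2 \<omega> - X' \<omega>) = m"
      by (auto simp: optimal_test_def A_def m_def)
    then have X'S: "(\<lambda>\<omega>. K2 \<omega> - X' \<omega>) \<in> S" by (auto simp: S_def)
    have min: "(LINT \<omega>|Q. K2 \<omega> - X' \<omega>) \<le> (LINT \<omega>|Q. K2 \<omega> - X \<omega>)" if "X \<in> A" for X
    proof -
      have "(\<lambda>\<omega>. K2 \<omega> - X \<omega>) \<in> S" using that by (auto simp: S_def)
      from Q_le[OF _ this, of "\<lambda>\<omega>. K2 \<omega> - X' \<omega>"] X'S SL X'(2) show ?thesis by auto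
    qed
    show "(LINT \<omega>|Q. K2 \<omega> - X' \<omega>) =
        (INF X\<in>admissible_tests \<mu> \<rho>1 K1 K2 \<alpha>. LINT \<omega>|Q. K2 \<omega> - X \<omega>)"
      unfolding A_def[symmetric]
    proof (rule antisym)
      show "(LINT \<omega>|Q. K2 \<omega> - X' \<omega>) \<le> (INF X\<in>A. LINT \<omega>|Q. K2 \<omega> - X \<omega>)"
        using X'(1) min by (intro cINF_greatest) auto
      show "(INF X\<in>A. LINT \<omega>|Q. K2 \<omega> - X \<omega>) \<le> (LINT \<omega>|Q. K2 \<omega> - X' \<omega>)"
        using X'(1) min by (intro cINF_lower bdd_belowI2)
    qed
  qed
qed

end
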